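(* Let $\mathbf{H}$ be a differentially cohesive topos and $\Sigma$ a $V$-manifold in $\mathbf{H}$. Consider two formally integrable PDEs $\mathcal{E},\mathcal{F}\in\mathrm{PDE}_{/\Sigma}(\mathbf{H})$, presented (via the equivalence $\mathrm{PDE}_{/\Sigma}(\mathbf{H})\simeq\mathrm{EM}(J^\infty_\Sigma)$) as coalgebras over $J^\infty_\Sigma$ with coaction morphisms $\rho_{\mathcal{E}}:\mathcal{E}\to J^\infty_\Sigma\mathcal{E}$ and $\rho_{\mathcal{F}}:\mathcal{F}\to J^\infty_\Sigma\mathcal{F}$. (a) The product $\mathcal{E}\times\mathcal{F}$ in $\mathbf{H}_{/\Sigma}$ has the coalgebra structure $$\rho_{\mathcal{E}\times\mathcal{F}}=(\rho_{\mathcal{E}},\rho_{\mathcal{F}}):\mathcal{E}\times\mathcal{F}\to J^\infty_\Sigma\mathcal{E}\times J^\infty_\Sigma\mathcal{F}\simeq J^\infty_\Sigma(\mathcal{E}\times\mathcal{F}),$$ which makes it into the product of $\mathcal{E}$ and $\mathcal{F}$ in $\mathrm{PDE}_{/\Sigma}(\mathbf{H})$. (b) For any pair of coalgebra morphisms $f,g:\mathcal{E}\to\mathcal{F}$, the equalizer $e:\mathcal{K}\hookrightarrow\mathcal{E}$ of $f$ and $g$ in $\mathbf{H}_{/\Sigma}$ has a unique coalgebra structure $\rho_{\mathcal{K}}:\mathcal{K}\to J^\infty_\Sigma\mathcal{K}$ that makes $e:\mathcal{K}\to\mathcal{E}$ into a morphism of coalgebras, and moreover with it $e$ is the equalizer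 of $f$ and $g$ in $\mathrm{PDE}_{/\Sigma}(\mathbf{H})$. (c) Suppose $\mathcal{E}=J^\infty_\Sigma Y$, $\mathcal{F}=J^\infty_\Sigma Z$ (cofree coalgebras) and $f=p^\infty f_0$, $g=p^\infty g_0$ for some differential operators $f_0,g_0:J^\infty_\Sigma Y\to Z$. Then the equalizer $\mathcal{K}$ of $p^\infty f_0$ and $p^\infty g_0$ in $\mathrm{PDE}_{/\Sigma}(\mathbf{H})$ coincides with the prolongation of the equalizer $e_0:\mathcal{K}_0\hookrightarrow J^\infty_\Sigma Y$ of $f_0,g_0:J^\infty_\Sigma Y\rightrightarrows Z$ in $\mathbf{H}_{/\Sigma}$; that is, $\mathcal{K}\simeq(\mathcal{K}_0)^\infty$ as formally integrable generalized PDEs.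
   Context: **Differential cohesion.** A differentially cohesive topos is a (Grothendieck) topos $\mathbf{H}$ with a full inclusion of toposes $i_!:\mathbf{H}_\Re\hookrightarrow\mathbf{H}$ having three successive right adjoints, $i_!\dashv i^\ast\dashv i_\ast\dashv i^!$. Set $\Im:=i_\ast i^\ast$ with unit $\eta:\mathrm{id}\to\Im$. A morphism $f:X\to Y$ is formally étale if the naturality square of $\eta$ on $f$ is a pullback. For $V$ a group object in $\mathbf{H}$, a $V$-manifold is an object $X$ for which there is a span $V\leftarrow U\to X$ with both legs formally étale and the right leg an epimorphism. **Disk bundles and jets.** For $f:X\to Y$ there is the base change triple $f_!\dashv f^\ast\dashv f_\ast$ between slices. Set $T^\infty_\Sigma:=(\eta_\Sigma)^\ast(\eta_\Sigma)_!$ (a monad on $\mathbf{H}_{/\Sigma}$, unit $\eta^T$) and $J^\infty_\Sigma:=(\eta_\Sigma)^\ast(\eta_\Sigma)_\ast$ (a comonad, counit $\epsilon$, coproduct $\Delta$); $T^\infty_\Sigma\dashv J^\infty_\Sigma$. For $\sigma:T^\infty_\Sigma X\to Y$ write $\widetilde\sigma:X\to J^\infty_\Sigma Y$ for its adjunct. A (formal, generalized) differential operator is a morphism $D:J^\infty_\Sigma Y\to Z$ in $\mathbf{H}_{/\Sigma}$; its infinite prolongation is $p^\infty D:=J^\infty_\Sigma D\circ\Delta_Y:J^\infty_\Sigma Y\to J^\infty_\Sigma Z$. **Generalized PDEs.** A generalized PDE over $\Sigma$ is a monomorphism $e_Y:\mathcal{E}\hookrightarrow J^\infty_\Sigma Y$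 in $\mathbf{H}_{/\Sigma}$. For $E\in\mathbf{H}_{/\Sigma}$, an $E$-parametrized family of formal solutions of it is a morphism $s_E:T^\infty_\Sigma E\to\mathcal{E}$ such that $\sigma_E:=e_Y\circ s_E$ satisfies $\Delta_Y\circ\sigma_E\circ\eta^T_E=\widetilde{\sigma_E}:E\to J^\infty_\Sigma J^\infty_\Sigma Y$. The prolongation $e^\infty_Y:\mathcal{E}^\infty\hookrightarrow J^\infty_\Sigma Y$ is the pullback of $J^\infty_\Sigma e_Y:J^\infty_\Sigma\mathcal{E}\to J^\infty_\Sigma J^\infty_\Sigma Y$ along $\Delta_Y$, with other projection $\rho^\infty_{\mathcal{E}}:\mathcal{E}^\infty\to J^\infty_\Sigma\mathcal{E}$; its canonical inclusion is $e^\infty_{\mathcal{E}}:=\epsilon_{\mathcal{E}}\circ\rho^\infty_{\mathcal{E}}:\mathcal{E}^\infty\hookrightarrow\mathcal{E}$. The PDE is formally integrable if $e^\infty_{\mathcal{E}}$ is an isomorphism. $\mathrm{PDE}_{/\Sigma}(\mathbf{H})$ has as objects the formally integrable generalized PDEs and as morphisms the $\mathbf{H}_{/\Sigma}$-morphisms $\phi:\mathcal{E}\to\mathcal{E}'$ such that composition with $\phi$ sends parametrized families of formal solutions of $\mathcal{E}$ to such families of $\mathcal{E}'$. **Coalgebras.** $\mathrm{EM}(J)$ has objects $(\mathcal{E},\rho:\mathcal{E}\to J\mathcal{E})$ with $\epsilon_{\mathcal{E}}\circ\rho=\mathrm{id}$ and $J\rho\circ\rho=\Delta_{\mathcal{E}}\circ\rho$;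 morphisms are maps $\phi$ with $\rho'\circ\phi=J\phi\circ\rho$. The cofree coalgebra on $Y$ is $(J Y,\Delta_Y)$. The equivalence $\mathrm{PDE}_{/\Sigma}(\mathbf{H})\simeq\mathrm{EM}(J^\infty_\Sigma)$ sends a formally integrable $\mathcal{E}\hookrightarrow J^\infty_\Sigma Y$ to $\mathcal{E}$ with coaction $\rho_{\mathcal{E}}=\rho^\infty_{\mathcal{E}}\circ(e^\infty_{\mathcal{E}})^{-1}$, is the identity on underlying morphisms, and has inverse sending a coalgebra $\rho_{\mathcal{E}}$ to the PDE $\rho_{\mathcal{E}}:\mathcal{E}\hookrightarrow J^\infty_\Sigma\mathcal{E}$. *)

theory Defs
  imports Main "HOL-Library.FuncSet"
begin

unbundle cardinal_syntax

section \<open>Categories, functors, adjunctions\<close>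

record ('o, 'a) cat =
  Obj :: "'o set"
  Arr :: "'a set"
  Dom :: "'a \<Rightarrow> 'o"
  Cod :: "'a \<Rightarrow> 'o"
  Ide :: "'o \<Rightarrow> 'a"
  Comp :: "'a \<Rightarrow> 'a \<Rightarrow> 'a"  (infixr \<open>\<cdot>\<index>\<close> 70)

definition hom :: "('o, 'a) cat \<Rightarrow> 'o \<Rightarrow> 'o \<Rightarrow> 'a set" where
  "hom C a b = {f \<in> Arr C. Dom C f = a \<and> Cod C f = b}"

locale category =
  fixes C :: "('o, 'a) cat"
  assumes dom_obj: "f \<in> Arr C \<Longrightarrow> Dom C f \<in> Obj C"
    and cod_obj: "f \<in> Arr C \<Longrightarrow> Cod C f \<in> Obj C"
    and ide_hom: "a \<in> Obj C \<Longrightarrow> Ide C a \<in> hom C a a"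
    and comp_hom: "f \<in> hom C a b \<Longrightarrow> g \<in> hom C b c \<Longrightarrow> g \<cdot>\<^bsub>C\<^esub> f \<in> hom C a c"
    and comp_ide_right: "f \<in> hom C a b \<Longrightarrow> f \<cdot>\<^bsub>C\<^esub> Ide C a = f"
    and comp_ide_left: "f \<in> hom C a b \<Longrightarrow> Ide C b \<cdot>\<^bsub>C\<^esub> f = f"
    and comp_assoc: "f \<in> hom C a b \<Longrightarrow> g \<in> hom C b c \<Longrightarrow> h \<in> hom C c d
          \<Longrightarrow> (h \<cdot>\<^bsub>C\<^esub> g) \<cdot>\<^bsub>C\<^esub> f = h \<cdot>\<^bsub>C\<^esub> (g \<cdot>\<^bsub>C\<^esub> f)"

definition inverse_arrows :: "('o, 'a) cat \<Rightarrow> 'a \<Rightarrow> 'a \<Rightarrow> bool" where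
  "inverse_arrows C f g \<longleftrightarrow> (\<exists>a b. f \<in> hom C a b \<and> g \<in> hom C b a
      \<and> g \<cdot>\<^bsub>C\<^esub> f = Ide C a \<and> f \<cdot>\<^bsub>C\<^esub> g = Ide C b)"

definition is_iso :: "('o, 'a) cat \<Rightarrow> 'a \<Rightarrow> bool" where
  "is_iso C f \<longleftrightarrow> (\<exists>g. inverse_arrows C f g)"

definition inv_arr :: "('o, 'a) cat \<Rightarrow> 'a \<Rightarrow> 'a" where
  "inv_arr C f = (THE g. inverse_arrows C f g)"

definition monic :: "('o, 'a) cat \<Rightarrow> 'a \<Rightarrow> bool" where
  "monic C f \<longleftrightarrow> f \<in> Arr C \<and> (\<forall>x. \<forall>u \<in> hom C x (Dom C f). \<forall>v \<in> hom C x (Dom C f).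
      f \<cdot>\<^bsub>C\<^esub> u = f \<cdot>\<^bsub>C\<^esub> v \<longrightarrow> u = v)"

definition epic :: "('o, 'a) cat \<Rightarrow> 'a \<Rightarrow> bool" where
  "epic C f \<longleftrightarrow> f \<in> Arr C \<and> (\<forall>x. \<forall>u \<in> hom C (Cod C f) x. \<forall>v \<in> hom C (Cod C f) x.
      u \<cdot>\<^bsub>C\<^esub> f = v \<cdot>\<^bsub>C\<^esub> f \<longrightarrow> u = v)"

definition is_terminal :: "('o, 'a) cat \<Rightarrow> 'o \<Rightarrow> bool" where
  "is_terminal C t \<longleftrightarrow> t \<in> Obj C \<and> (\<forall>x \<in> Obj C. \<exists>!u. u \<in> hom C x t)"

definition is_product :: "('o, 'a) cat \<Rightarrow> 'o \<Rightarrow> 'o \<Rightarrow> 'o \<Rightarrow> 'a \<Rightarrow> 'a \<Rightarrow> bool" where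
  "is_product C a b x p q \<longleftrightarrow> p \<in> hom C x a \<and> q \<in> hom C x b
     \<and> (\<forall>t. \<forall>u \<in> hom C t a. \<forall>v \<in> hom C t b.
          \<exists>!w. w \<in> hom C t x \<and> p \<cdot>\<^bsub>C\<^esub> w = u \<and> q \<cdot>\<^bsub>C\<^esub> w = v)"

text \<open>The arrow \<open>(u, v)\<close> into a product with projections \<open>p\<close>, \<open>q\<close>.\<close>

definition tuple :: "('o, 'a) cat \<Rightarrow> 'a \<Rightarrow> 'a \<Rightarrow> 'a \<Rightarrow> 'a \<Rightarrow> 'a" where
  "tuple C p q u v = (THE w. w \<in> hom C (Dom C u) (Dom C p) \<and> p \<cdot>\<^bsub>C\<^esub> w = u \<and> q \<cdot>\<^bsub>C\<^esub> w = v)"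

definition is_equalizer :: "('o, 'a) cat \<Rightarrow> 'a \<Rightarrow> 'a \<Rightarrow> 'a \<Rightarrow> bool" where
  "is_equalizer C f g e \<longleftrightarrow> (\<exists>a b k. f \<in> hom C a b \<and> g \<in> hom C a b \<and> e \<in> hom C k a
     \<and> f \<cdot>\<^bsub>C\<^esub> e = g \<cdot>\<^bsub>C\<^esub> e
     \<and> (\<forall>t. \<forall>u \<in> hom C t a. f \<cdot>\<^bsub>C\<^esub> u = g \<cdot>\<^bsub>C\<^esub> u \<longrightarrow> (\<exists>!w. w \<in> hom C t k \<and> e \<cdot>\<^bsub>C\<^esub> w = u)))"

text \<open>\<open>p\<close> and \<open>q\<close> are the projections of a pullback of the cospan \<open>f\<close>, \<open>g\<close>, with \<open>f \<cdot> p = g \<cdot> q\<close>.\<close>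

definition is_pullback :: "('o, 'a) cat \<Rightarrow> 'a \<Rightarrow> 'a \<Rightarrow> 'a \<Rightarrow> 'a \<Rightarrow> bool" where
  "is_pullback C f g p q \<longleftrightarrow> (\<exists>a b c x. f \<in> hom C a c \<and> g \<in> hom C b c \<and> p \<in> hom C x a \<and> q \<in> hom C x b
     \<and> f \<cdot>\<^bsub>C\<^esub> p = g \<cdot>\<^bsub>C\<^esub> q
     \<and> (\<forall>t. \<forall>u \<in> hom C t a. \<forall>v \<in> hom C t b. f \<cdot>\<^bsub>C\<^esub> u = g \<cdot>\<^bsub>C\<^esub> v
          \<longrightarrow> (\<exists>!w. w \<in> hom C t x \<and> p \<cdot>\<^bsub>C\<^esub> w = u \<and> q \<cdot>\<^bsub>C\<^esub> w = v)))"

record ('o, 'a, 'p, 'b) ftr =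
  fobj :: "'o \<Rightarrow> 'p"
  farr :: "'a \<Rightarrow> 'b"

definition ftr_id :: "('o, 'a, 'o, 'a) ftr" where
  "ftr_id = \<lparr>fobj = (\<lambda>a. a), farr = (\<lambda>f. f)\<rparr>"

definition ftr_comp :: "('p, 'b, 'q, 'c) ftr \<Rightarrow> ('o, 'a, 'p, 'b) ftr \<Rightarrow> ('o, 'a, 'q, 'c) ftr" where
  "ftr_comp G F = \<lparr>fobj = fobj G \<circ> fobj F, farr = farr G \<circ> farr F\<rparr>"

locale is_functor =
  src: category C + tgt: category D
  for C :: "('o, 'a) cat" and D :: "('p, 'b) cat" +
  fixes F :: "('o, 'a, 'p, 'b) ftr"
  assumes map_obj: "a \<in> Obj C \<Longrightarrow> fobj F a \<in> Obj D"
    and map_hom: "f \<in> hom C a b \<Longrightarrow> farr F f \<in> hom D (fobj F a) (fobj F b)"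
    and map_ide: "a \<in> Obj C \<Longrightarrow> farr F (Ide C a) = Ide D (fobj F a)"
    and map_comp: "f \<in> hom C a b \<Longrightarrow> g \<in> hom C b c
          \<Longrightarrow> farr F (g \<cdot>\<^bsub>C\<^esub> f) = farr F g \<cdot>\<^bsub>D\<^esub> farr F f"

definition fully_faithful ::
  "('o, 'a) cat \<Rightarrow> ('p, 'b) cat \<Rightarrow> ('o, 'a, 'p, 'b) ftr \<Rightarrow> bool" where
  "fully_faithful C D F \<longleftrightarrow> (\<forall>a \<in> Obj C. \<forall>b \<in> Obj C.
      bij_betw (farr F) (hom C a b) (hom D (fobj F a) (fobj F b)))"

definition nat_trans :: "('o, 'a) cat \<Rightarrow> ('p, 'b) cat
    \<Rightarrow> ('o, 'a, 'p, 'b) ftr \<Rightarrow> ('o, 'a, 'p, 'b) ftr \<Rightarrow> ('o \<Rightarrow> 'b) \<Rightarrow> bool" where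
  "nat_trans C D F G \<tau> \<longleftrightarrow>
     (\<forall>a \<in> Obj C. \<tau> a \<in> hom D (fobj F a) (fobj G a)) \<and>
     (\<forall>a b. \<forall>f \<in> hom C a b. \<tau> b \<cdot>\<^bsub>D\<^esub> farr F f = farr G f \<cdot>\<^bsub>D\<^esub> \<tau> a)"

definition nat_iso :: "('o, 'a) cat \<Rightarrow> ('p, 'b) cat
    \<Rightarrow> ('o, 'a, 'p, 'b) ftr \<Rightarrow> ('o, 'a, 'p, 'b) ftr \<Rightarrow> ('o \<Rightarrow> 'b) \<Rightarrow> bool" where
  "nat_iso C D F G \<tau> \<longleftrightarrow> nat_trans C D F G \<tau> \<and> (\<forall>a \<in> Obj C. is_iso D (\<tau> a))"

definition equivalent_cats :: "('o, 'a) cat \<Rightarrow> ('p, 'b) cat \<Rightarrow> bool" where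
  "equivalent_cats C D \<longleftrightarrow> (\<exists>F G \<phi> \<psi>. is_functor C D F \<and> is_functor D C G
     \<and> nat_iso C C ftr_id (ftr_comp G F) \<phi> \<and> nat_iso D D (ftr_comp F G) ftr_id \<psi>)"

record ('o, 'a, 'p, 'b) adj =
  left_adj :: "('o, 'a, 'p, 'b) ftr"
  right_adj :: "('p, 'b, 'o, 'a) ftr"
  adj_unit :: "'o \<Rightarrow> 'a"
  adj_counit :: "'p \<Rightarrow> 'b"

text \<open>\<open>left_adj A : C \<rightarrow> D\<close> is left adjoint to \<open>right_adj A : D \<rightarrow> C\<close>.\<close>

locale adjunction =
  L: is_functor C D "left_adj A" + R: is_functor D C "right_adj A"
  for C :: "('o, 'a) cat" and D :: "('p, 'b) cat" and A :: "('o, 'a, 'p, 'b) adj" +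
  assumes unit_nat: "nat_trans C C ftr_id (ftr_comp (right_adj A) (left_adj A)) (adj_unit A)"
    and counit_nat: "nat_trans D D (ftr_comp (left_adj A) (right_adj A)) ftr_id (adj_counit A)"
    and triangle_left: "a \<in> Obj C \<Longrightarrow>
          adj_counit A (fobj (left_adj A) a) \<cdot>\<^bsub>D\<^esub> farr (left_adj A) (adj_unit A a)
            = Ide D (fobj (left_adj A) a)"
    and triangle_right: "x \<in> Obj D \<Longrightarrow>
          farr (right_adj A) (adj_counit A x) \<cdot>\<^bsub>C\<^esub> adj_unit A (fobj (right_adj A) x)
            = Ide C (fobj (right_adj A) x)"


section \<open>Grothendieck toposes\<close>

text \<open>
  Size is measured against a type \<open>'u\<close> whose cardinality is a regular strong limit: ``small'' means
  of smaller cardinality than \<open>'u\<close>. Every small set is then in bijection with a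
  small subset of \<open>'u\<close>, so small sets, small sites and sheaves can be taken with elements in
  \<open>'u\<close>. The cardinality is not required to be uncountable: the usual toposes are those over an
  uncountable \<open>'u\<close>, and a countable \<open>'u\<close> gives the toposes relative to the universe of
  hereditarily finite sets.
\<close>

definition small :: "'u itself \<Rightarrow> 'x set \<Rightarrow> bool" where
  "small U A \<longleftrightarrow> |A| <o |UNIV :: 'u set|"

definition grothendieck_universe :: "'u itself \<Rightarrow> bool" where
  "grothendieck_universe U \<longleftrightarrow> infinite (UNIV :: 'u set)
     \<and> (\<forall>A :: 'u set. small U A \<longrightarrow> small U (Pow A))
     \<and> (\<forall>(I :: 'u set) (A :: 'u \<Rightarrow> 'u set).
          small U I \<longrightarrow> (\<forall>i \<in> I. small U (A i)) \<longrightarrow> small U (\<Union>i \<in> I. A i))"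

definition max_sieve :: "('c, 'd) cat \<Rightarrow> 'c \<Rightarrow> 'd set" where
  "max_sieve C c = {f \<in> Arr C. Cod C f = c}"

definition sieve :: "('c, 'd) cat \<Rightarrow> 'c \<Rightarrow> 'd set \<Rightarrow> bool" where
  "sieve C c S \<longleftrightarrow> S \<subseteq> max_sieve C c \<and>
     (\<forall>f \<in> S. \<forall>a. \<forall>g \<in> hom C a (Dom C f). f \<cdot>\<^bsub>C\<^esub> g \<in> S)"

definition pullback_sieve :: "('c, 'd) cat \<Rightarrow> 'd \<Rightarrow> 'd set \<Rightarrow> 'd set" where
  "pullback_sieve C h S = {g \<in> max_sieve C (Dom C h). h \<cdot>\<^bsub>C\<^esub> g \<in> S}"

locale site = category C for C :: "('c, 'd) cat" +
  fixes K :: "'c \<Rightarrow> 'd set set"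
  assumes cover_sieve: "c \<in> Obj C \<Longrightarrow> S \<in> K c \<Longrightarrow> sieve C c S"
    and cover_max: "c \<in> Obj C \<Longrightarrow> max_sieve C c \<in> K c"
    and cover_stable: "S \<in> K c \<Longrightarrow> h \<in> hom C d c \<Longrightarrow> pullback_sieve C h S \<in> K d"
    and cover_trans: "c \<in> Obj C \<Longrightarrow> S \<in> K c \<Longrightarrow> sieve C c R
          \<Longrightarrow> (\<forall>h \<in> S. pullback_sieve C h R \<in> K (Dom C h)) \<Longrightarrow> R \<in> K c"

record ('c, 'd, 'u) presheaf =
  sections :: "'c \<Rightarrow> 'u set"
  restr :: "'d \<Rightarrow> 'u \<Rightarrow> 'u"

definition is_presheaf :: "('c, 'd) cat \<Rightarrow> ('c, 'd, 'u) presheaf \<Rightarrow> bool" where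
  "is_presheaf C F \<longleftrightarrow>
     (\<forall>c \<in> Obj C. small TYPE('u) (sections F c)) \<and>
     (\<forall>c d. \<forall>f \<in> hom C c d. restr F f \<in> sections F d \<rightarrow> sections F c) \<and>
     (\<forall>c \<in> Obj C. \<forall>x \<in> sections F c. restr F (Ide C c) x = x) \<and>
     (\<forall>b c d. \<forall>g \<in> hom C b c. \<forall>f \<in> hom C c d. \<forall>x \<in> sections F d.
        restr F (f \<cdot>\<^bsub>C\<^esub> g) x = restr F g (restr F f x))"

definition matching_family ::
  "('c, 'd) cat \<Rightarrow> ('c, 'd, 'u) presheaf \<Rightarrow> 'd set \<Rightarrow> ('d \<Rightarrow> 'u) \<Rightarrow> bool" where
  "matching_family C F S x \<longleftrightarrow>
     (\<forall>f \<in> S. x f \<in> sections F (Dom C f)) \<and>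
     (\<forall>f \<in> S. \<forall>a. \<forall>g \<in> hom C a (Dom C f). x (f \<cdot>\<^bsub>C\<^esub> g) = restr F g (x f))"

definition is_sheaf ::
  "('c, 'd) cat \<Rightarrow> ('c \<Rightarrow> 'd set set) \<Rightarrow> ('c, 'd, 'u) presheaf \<Rightarrow> bool" where
  "is_sheaf C K F \<longleftrightarrow> is_presheaf C F \<and>
     (\<forall>c \<in> Obj C. \<forall>S \<in> K c. \<forall>x. matching_family C F S x \<longrightarrow>
        (\<exists>!s. s \<in> sections F c \<and> (\<forall>f \<in> S. restr F f s = x f)))"

text \<open>Arrows carry their source and target; components are functions that are undefined off
  their domain, so that equality of arrows is equality of natural transformations.\<close>

definition sheaf_cat :: "('c, 'd) cat \<Rightarrow> ('c \<Rightarrow> 'd set set)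
    \<Rightarrow> (('c, 'd, 'u) presheaf, ('c, 'd, 'u) presheaf \<times> ('c \<Rightarrow> 'u \<Rightarrow> 'u) \<times> ('c, 'd, 'u) presheaf) cat" where
  "sheaf_cat C K = \<lparr>
     Obj = {F. is_sheaf C K F},
     Arr = {(F, \<alpha>, G). is_sheaf C K F \<and> is_sheaf C K G
        \<and> \<alpha> \<in> (\<Pi>\<^sub>E c \<in> Obj C. sections F c \<rightarrow>\<^sub>E sections G c)
        \<and> (\<forall>c d. \<forall>f \<in> hom C c d. \<forall>x \<in> sections F d. \<alpha> c (restr F f x) = restr G f (\<alpha> d x))},
     Dom = (\<lambda>(F, \<alpha>, G). F),
     Cod = (\<lambda>(F, \<alpha>, G). G),
     Ide = (\<lambda>F. (F, \<lambda>c \<in> Obj C. \<lambda>x \<in> sections F c. x, F)),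
     Comp = (\<lambda>(F', \<beta>, G) (F, \<alpha>, G'). (F, \<lambda>c \<in> Obj C. \<lambda>x \<in> sections F c. \<beta> c (\<alpha> c x), G))\<rparr>"

definition grothendieck_topos :: "'u itself \<Rightarrow> ('o, 'a) cat \<Rightarrow> bool" where
  "grothendieck_topos U H \<longleftrightarrow> grothendieck_universe U \<and> category H \<and>
     (\<exists>(C :: ('u, 'u) cat) K. site C K \<and> small U (Obj C) \<and> small U (Arr C) \<and>
        equivalent_cats H
          (sheaf_cat C K ::
            (('u, 'u, 'u) presheaf, ('u, 'u, 'u) presheaf \<times> ('u \<Rightarrow> 'u \<Rightarrow> 'u) \<times> ('u, 'u, 'u) presheaf) cat))"


section \<open>Differential cohesion\<close>

text \<open>\<open>adj1\<close>, \<open>adj2\<close>, \<open>adj3\<close> are the adjunctions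
  \<open>i\<^sub>! \<stileturn> i\<^sup>*\<close>, \<open>i\<^sup>* \<stileturn> i\<^sub>*\<close>, \<open>i\<^sub>* \<stileturn> i\<^sup>!\<close>.\<close>

record ('o, 'a, 'p, 'b) cohesion =
  ambient :: "('o, 'a) cat"
  reduced :: "('p, 'b) cat"
  adj1 :: "('p, 'b, 'o, 'a) adj"
  adj2 :: "('o, 'a, 'p, 'b) adj"
  adj3 :: "('p, 'b, 'o, 'a) adj"

definition differentially_cohesive_topos ::
  "'u itself \<Rightarrow> ('o, 'a, 'p, 'b) cohesion \<Rightarrow> bool" where
  "differentially_cohesive_topos U X \<longleftrightarrow>
     grothendieck_topos U (ambient X) \<and> grothendieck_topos U (reduced X)
     \<and> adjunction (reduced X) (ambient X) (adj1 X)
     \<and> adjunction (ambient X) (reduced X) (adj2 X)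
     \<and> adjunction (reduced X) (ambient X) (adj3 X)
     \<and> right_adj (adj1 X) = left_adj (adj2 X)
     \<and> right_adj (adj2 X) = left_adj (adj3 X)
     \<and> fully_faithful (reduced X) (ambient X) (left_adj (adj1 X))"

definition Im_ftr :: "('o, 'a, 'p, 'b) cohesion \<Rightarrow> ('o, 'a, 'o, 'a) ftr" where
  "Im_ftr X = ftr_comp (right_adj (adj2 X)) (left_adj (adj2 X))"

definition Im_unit :: "('o, 'a, 'p, 'b) cohesion \<Rightarrow> 'o \<Rightarrow> 'a" where
  "Im_unit X = adj_unit (adj2 X)"

definition formally_etale :: "('o, 'a, 'p, 'b) cohesion \<Rightarrow> 'a \<Rightarrow> bool" where
  "formally_etale X f \<longleftrightarrow> is_pullback (ambient X)
     (Im_unit X (Cod (ambient X) f)) (farr (Im_ftr X) f) f (Im_unit X (Dom (ambient X) f))"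

text \<open>The last five conditions are associativity, the unit laws and the inverse laws;
  \<open>p\<close>, \<open>q\<close> are the projections of \<open>V \<times> V\<close>, and \<open>p'\<close>, \<open>q'\<close> those of \<open>(V \<times> V) \<times> V\<close>.\<close>

definition group_object :: "('o, 'a) cat \<Rightarrow> 'o \<Rightarrow> bool" where
  "group_object C V \<longleftrightarrow> (\<exists>t b W p q W' p' q' m e i.
     is_terminal C t \<and> b \<in> hom C V t
     \<and> is_product C V V W p q \<and> is_product C W V W' p' q'
     \<and> m \<in> hom C W V \<and> e \<in> hom C t V \<and> i \<in> hom C V V
     \<and> m \<cdot>\<^bsub>C\<^esub> tuple C p q (m \<cdot>\<^bsub>C\<^esub> p') q'
         = m \<cdot>\<^bsub>C\<^esub> tuple C p q (p \<cdot>\<^bsub>C\<^esub> p') (m \<cdot>\<^bsub>C\<^esub> tuple C p q (q \<cdot>\<^bsub>C\<^esub> p') q')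
     \<and> m \<cdot>\<^bsub>C\<^esub> tuple C p q (e \<cdot>\<^bsub>C\<^esub> b) (Ide C V) = Ide C V
     \<and> m \<cdot>\<^bsub>C\<^esub> tuple C p q (Ide C V) (e \<cdot>\<^bsub>C\<^esub> b) = Ide C V
     \<and> m \<cdot>\<^bsub>C\<^esub> tuple C p q i (Ide C V) = e \<cdot>\<^bsub>C\<^esub> b
     \<and> m \<cdot>\<^bsub>C\<^esub> tuple C p q (Ide C V) i = e \<cdot>\<^bsub>C\<^esub> b)"

definition V_manifold :: "('o, 'a, 'p, 'b) cohesion \<Rightarrow> 'o \<Rightarrow> 'o \<Rightarrow> bool" where
  "V_manifold X V M \<longleftrightarrow> M \<in> Obj (ambient X) \<and>
     (\<exists>U. \<exists>l \<in> hom (ambient X) U V. \<exists>r \<in> hom (ambient X) U M.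
        formally_etale X l \<and> formally_etale X r \<and> epic (ambient X) r)"


section \<open>Slices and base change\<close>

definition slice :: "('o, 'a) cat \<Rightarrow> 'o \<Rightarrow> ('a, 'a \<times> 'a \<times> 'a) cat" where
  "slice H X = \<lparr>
     Obj = {p \<in> Arr H. Cod H p = X},
     Arr = {(p, h, q). p \<in> Arr H \<and> q \<in> Arr H \<and> Cod H p = X \<and> Cod H q = X
              \<and> h \<in> hom H (Dom H p) (Dom H q) \<and> q \<cdot>\<^bsub>H\<^esub> h = p},
     Dom = (\<lambda>(p, h, q). p),
     Cod = (\<lambda>(p, h, q). q),
     Ide = (\<lambda>p. (p, Ide H (Dom H p), p)),
     Comp = (\<lambda>(q', k, r) (p, h, q). (p, k \<cdot>\<^bsub>H\<^esub> h, r))\<rparr>"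

text \<open>The functor \<open>f\<^sub>!\<close>.\<close>

definition postcomp :: "('o, 'a) cat \<Rightarrow> 'a \<Rightarrow> ('a, 'a \<times> 'a \<times> 'a, 'a, 'a \<times> 'a \<times> 'a) ftr" where
  "postcomp H f = \<lparr>fobj = (\<lambda>p. f \<cdot>\<^bsub>H\<^esub> p), farr = (\<lambda>(p, h, q). (f \<cdot>\<^bsub>H\<^esub> p, h, f \<cdot>\<^bsub>H\<^esub> q))\<rparr>"

text \<open>
  An adjoint triple \<open>f\<^sub>! \<stileturn> f\<^sup>* \<stileturn> f\<^sub>*\<close> between categories \<open>base B\<close> and \<open>total B\<close>:
  \<open>sum_adj B\<close> is \<open>f\<^sub>! \<stileturn> f\<^sup>*\<close> and \<open>prod_adj B\<close> is \<open>f\<^sup>* \<stileturn> f\<^sub>*\<close>.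
\<close>

record ('o, 'a, 'p, 'b) adj_triple =
  base :: "('o, 'a) cat"
  total :: "('p, 'b) cat"
  sum_adj :: "('o, 'a, 'p, 'b) adj"
  prod_adj :: "('p, 'b, 'o, 'a) adj"

text \<open>
  The functors \<open>f\<^sup>*\<close> and \<open>f\<^sub>*\<close> are only determined up to isomorphism; this says that \<open>B\<close> is one
  choice of the base change triple. The object \<open>f\<^sup>* p\<close> is a pullback of \<open>p\<close> along \<open>f\<close>, the other
  projection being the arrow of \<open>H\<close> underlying the counit at \<open>p\<close>.
\<close>

definition base_change_triple ::
  "('o, 'a) cat \<Rightarrow> 'a \<Rightarrow> ('a, 'a \<times> 'a \<times> 'a, 'a, 'a \<times> 'a \<times> 'a) adj_triple \<Rightarrow> bool" where
  "base_change_triple H f B \<longleftrightarrow>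
     base B = slice H (Dom H f) \<and> total B = slice H (Cod H f)
     \<and> adjunction (base B) (total B) (sum_adj B)
     \<and> adjunction (total B) (base B) (prod_adj B)
     \<and> left_adj (sum_adj B) = postcomp H f
     \<and> right_adj (sum_adj B) = left_adj (prod_adj B)
     \<and> (\<forall>p \<in> Obj (total B). is_pullback H f p
          (fobj (right_adj (sum_adj B)) p) (fst (snd (adj_counit (sum_adj B) p))))"


section \<open>Jets and infinitesimal disks\<close>

definition disk :: "('o, 'a, 'p, 'b) adj_triple \<Rightarrow> ('o, 'a, 'o, 'a) ftr" where
  "disk B = ftr_comp (right_adj (sum_adj B)) (left_adj (sum_adj B))"

definition disk_unit :: "('o, 'a, 'p, 'b) adj_triple \<Rightarrow> 'o \<Rightarrow> 'a" where
  "disk_unit B = adj_unit (sum_adj B)"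

definition jet :: "('o, 'a, 'p, 'b) adj_triple \<Rightarrow> ('o, 'a, 'o, 'a) ftr" where
  "jet B = ftr_comp (left_adj (prod_adj B)) (right_adj (prod_adj B))"

definition jet_counit :: "('o, 'a, 'p, 'b) adj_triple \<Rightarrow> 'o \<Rightarrow> 'a" where
  "jet_counit B = adj_counit (prod_adj B)"

definition jet_coprod :: "('o, 'a, 'p, 'b) adj_triple \<Rightarrow> 'o \<Rightarrow> 'a" where
  "jet_coprod B Y = farr (left_adj (prod_adj B))
     (adj_unit (prod_adj B) (fobj (right_adj (prod_adj B)) Y))"

text \<open>The adjunct \<open>X \<rightarrow> J Y\<close> of \<open>\<sigma> : T X \<rightarrow> Y\<close> under the composite adjunction
  \<open>T = f\<^sup>* f\<^sub>! \<stileturn> f\<^sup>* f\<^sub>* = J\<close>.\<close>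

definition adjunct :: "('o, 'a, 'p, 'b) adj_triple \<Rightarrow> 'o \<Rightarrow> 'a \<Rightarrow> 'a" where
  "adjunct B X \<sigma> = farr (right_adj (sum_adj B))
       (farr (right_adj (prod_adj B)) \<sigma>
          \<cdot>\<^bsub>total B\<^esub> adj_unit (prod_adj B) (fobj (left_adj (sum_adj B)) X))
     \<cdot>\<^bsub>base B\<^esub> adj_unit (sum_adj B) X"

text \<open>The infinite prolongation of \<open>D : J Y \<rightarrow> Z\<close>.\<close>

definition op_prolong :: "('o, 'a, 'p, 'b) adj_triple \<Rightarrow> 'o \<Rightarrow> 'a \<Rightarrow> 'a" where
  "op_prolong B Y D = farr (jet B) D \<cdot>\<^bsub>base B\<^esub> jet_coprod B Y"


section \<open>Generalized PDEs\<close>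

text \<open>A generalized PDE \<open>e : \<E> \<rightarrow> J Y\<close> is encoded as the pair \<open>(Y, e)\<close>; \<open>Y\<close> cannot be recovered
  from \<open>e\<close>.\<close>

definition pde_carrier :: "('o, 'a, 'p, 'b) adj_triple \<Rightarrow> 'o \<times> 'a \<Rightarrow> 'o" where
  "pde_carrier B P = Dom (base B) (snd P)"

definition generalized_pde :: "('o, 'a, 'p, 'b) adj_triple \<Rightarrow> 'o \<times> 'a \<Rightarrow> bool" where
  "generalized_pde B P \<longleftrightarrow> fst P \<in> Obj (base B)
     \<and> snd P \<in> hom (base B) (pde_carrier B P) (fobj (jet B) (fst P)) \<and> monic (base B) (snd P)"

definition formal_solutions :: "('o, 'a, 'p, 'b) adj_triple \<Rightarrow> 'o \<times> 'a \<Rightarrow> 'o \<Rightarrow> 'a set" where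
  "formal_solutions B P E = {s \<in> hom (base B) (fobj (disk B) E) (pde_carrier B P).
     jet_coprod B (fst P) \<cdot>\<^bsub>base B\<^esub> (snd P \<cdot>\<^bsub>base B\<^esub> s) \<cdot>\<^bsub>base B\<^esub> disk_unit B E
       = adjunct B E (snd P \<cdot>\<^bsub>base B\<^esub> s)}"

text \<open>\<open>e\<close> and \<open>\<rho>\<close> are the maps \<open>e\<^sup>\<infinity>\<^sub>Y\<close> and \<open>\<rho>\<^sup>\<infinity>\<^sub>\<E>\<close> out of a prolongation of \<open>P\<close>.\<close>

definition prolongation :: "('o, 'a, 'p, 'b) adj_triple \<Rightarrow> 'o \<times> 'a \<Rightarrow> 'a \<Rightarrow> 'a \<Rightarrow> bool" where
  "prolongation B P e \<rho> \<longleftrightarrow>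
     is_pullback (base B) (jet_coprod B (fst P)) (farr (jet B) (snd P)) e \<rho>"

definition canonical_inclusion :: "('o, 'a, 'p, 'b) adj_triple \<Rightarrow> 'o \<times> 'a \<Rightarrow> 'a \<Rightarrow> 'a" where
  "canonical_inclusion B P \<rho> = jet_counit B (pde_carrier B P) \<cdot>\<^bsub>base B\<^esub> \<rho>"

definition formally_integrable :: "('o, 'a, 'p, 'b) adj_triple \<Rightarrow> 'o \<times> 'a \<Rightarrow> bool" where
  "formally_integrable B P \<longleftrightarrow>
     (\<exists>e \<rho>. prolongation B P e \<rho> \<and> is_iso (base B) (canonical_inclusion B P \<rho>))"

definition PDE :: "('o, 'a, 'p, 'b) adj_triple
    \<Rightarrow> ('o \<times> 'a, ('o \<times> 'a) \<times> 'a \<times> ('o \<times> 'a)) cat" where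
  "PDE B = \<lparr>
     Obj = {P. generalized_pde B P \<and> formally_integrable B P},
     Arr = {(P, \<phi>, Q). generalized_pde B P \<and> formally_integrable B P
        \<and> generalized_pde B Q \<and> formally_integrable B Q
        \<and> \<phi> \<in> hom (base B) (pde_carrier B P) (pde_carrier B Q)
        \<and> (\<forall>E \<in> Obj (base B). \<forall>s \<in> formal_solutions B P E.
             \<phi> \<cdot>\<^bsub>base B\<^esub> s \<in> formal_solutions B Q E)},
     Dom = (\<lambda>(P, \<phi>, Q). P),
     Cod = (\<lambda>(P, \<phi>, Q). Q),
     Ide = (\<lambda>P. (P, Ide (base B) (pde_carrier B P), P)),
     Comp = (\<lambda>(Q', \<psi>, R) (P, \<phi>, Q). (P, \<psi> \<cdot>\<^bsub>base B\<^esub> \<phi>, R))\<rparr>"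


section \<open>Coalgebras\<close>

definition coalgebra :: "('o, 'a, 'p, 'b) adj_triple \<Rightarrow> 'o \<times> 'a \<Rightarrow> bool" where
  "coalgebra B X \<longleftrightarrow> (case X of (E, \<rho>) \<Rightarrow>
     E \<in> Obj (base B) \<and> \<rho> \<in> hom (base B) E (fobj (jet B) E)
     \<and> jet_counit B E \<cdot>\<^bsub>base B\<^esub> \<rho> = Ide (base B) E
     \<and> farr (jet B) \<rho> \<cdot>\<^bsub>base B\<^esub> \<rho> = jet_coprod B E \<cdot>\<^bsub>base B\<^esub> \<rho>)"

definition EM :: "('o, 'a, 'p, 'b) adj_triple
    \<Rightarrow> ('o \<times> 'a, ('o \<times> 'a) \<times> 'a \<times> ('o \<times> 'a)) cat" where
  "EM B = \<lparr>
     Obj = {X. coalgebra B X},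
     Arr = {(X, \<phi>, X'). coalgebra B X \<and> coalgebra B X'
        \<and> \<phi> \<in> hom (base B) (fst X) (fst X')
        \<and> snd X' \<cdot>\<^bsub>base B\<^esub> \<phi> = farr (jet B) \<phi> \<cdot>\<^bsub>base B\<^esub> snd X},
     Dom = (\<lambda>(X, \<phi>, X'). X),
     Cod = (\<lambda>(X, \<phi>, X'). X'),
     Ide = (\<lambda>X. (X, Ide (base B) (fst X), X)),
     Comp = (\<lambda>(X1, \<psi>, X') (X, \<phi>, X2). (X, \<psi> \<cdot>\<^bsub>base B\<^esub> \<phi>, X'))\<rparr>"

definition cofree :: "('o, 'a, 'p, 'b) adj_triple \<Rightarrow> 'o \<Rightarrow> 'o \<times> 'a" where
  "cofree B Y = (fobj (jet B) Y, jet_coprod B Y)"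

text \<open>The equivalence of \<open>PDE B\<close> and \<open>EM B\<close> on objects: \<open>presented_by B P X\<close> says that it sends
  the PDE \<open>P\<close> to the coalgebra \<open>X\<close>, that is, \<open>X\<close> is the carrier of \<open>P\<close> with coaction
  \<open>\<rho>\<^sup>\<infinity>\<^sub>\<E> \<cdot> (e\<^sup>\<infinity>\<^sub>\<E>)\<^sup>-\<^sup>1\<close>, which does not depend on the choice of the prolongation.\<close>

definition presented_by :: "('o, 'a, 'p, 'b) adj_triple \<Rightarrow> 'o \<times> 'a \<Rightarrow> 'o \<times> 'a \<Rightarrow> bool" where
  "presented_by B P X \<longleftrightarrow> P \<in> Obj (PDE B) \<and> fst X = pde_carrier B P
     \<and> (\<exists>e \<rho>. prolongation B P e \<rho> \<and> is_iso (base B) (canonical_inclusion B P \<rho>)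
          \<and> snd X = \<rho> \<cdot>\<^bsub>base B\<^esub> inv_arr (base B) (canonical_inclusion B P \<rho>))"

text \<open>Inversely, a coalgebra \<open>(E, \<rho>)\<close> is sent to the PDE \<open>\<rho> : E \<rightarrow> J E\<close>, which is encoded by
  the same pair.\<close>

definition pde_of_coalgebra :: "'o \<times> 'a \<Rightarrow> 'o \<times> 'a" where
  "pde_of_coalgebra X = (fst X, snd X)"

end

theory Submission
  imports Defs
begin

text \<open>
  Write \<open>J = f\<^sup>* f\<^sub>*\<close> for the jet comonad, \<open>f\<close> being the unit of the infinitesimal shape modality at
  \<open>\<Sigma>\<close>. The proof rests on two facts.

  First, \<open>J\<close> preserves limits: \<open>f\<^sub>*\<close> is right adjoint to \<open>f\<^sup>*\<close>, and \<open>f\<^sup>*\<close> is itself right adjoint to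
  \<open>f\<^sub>!\<close> (\<open>jet_product\<close>, \<open>jet_equalizer\<close>, \<open>jet_monic\<close>). Hence the forgetful functor from coalgebras
  creates limits. A coaction on a product or an equalizer is the factorization of the given coactions
  through the \<open>J\<close>-image of the limit cone; the coalgebra laws, and the property of being a coalgebra
  map, may be tested after composition with the legs, because the images of these under \<open>J\<close> and
  \<open>J J\<close> are still jointly monic.

  Secondly, the formally integrable PDEs are the same as coalgebras together with a monic coalgebra map
  into a cofree coalgebra (\<open>presented_byD\<close>, \<open>subcoalgebra_presented_by\<close>), and an arrow of carriers
  preserves families of formal solutions if and only if it is a coalgebra map
  (\<open>preserves_solutions_iff\<close>). For the latter, let \<open>T = f\<^sup>* f\<^sub>!\<close>, left adjoint to \<open>J\<close>, with unit \<open>\<eta>\<close>.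
  A map \<open>s : T A \<rightarrow> E\<close> is a solution precisely when its adjunct is \<open>\<rho> \<cdot> s \<cdot> \<eta>\<close>,
  and the map adjunct to \<open>\<rho>\<close> is a solution restricting to the identity along \<open>\<eta>\<close>, which detects
  coalgebra maps. So limits of PDEs are limits of coalgebras.

  The statement on differential operators follows by pasting: the prolongation of the equalizer
  \<open>e\<^sub>0\<close> of \<open>f\<^sub>0\<close> and \<open>g\<^sub>0\<close> is the pullback of \<open>J e\<^sub>0\<close> along the coproduct \<open>\<Delta>\<close>, and \<open>J e\<^sub>0\<close> is the
  equalizer of \<open>J f\<^sub>0\<close> and \<open>J g\<^sub>0\<close>; so the prolongation is the equalizer of the prolonged
  operators \<open>J f\<^sub>0 \<cdot> \<Delta>\<close> and \<open>J g\<^sub>0 \<cdot> \<Delta>\<close> (\<open>prolongation_equalizer\<close>).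
\<close>

section \<open>Categories\<close>

context category
begin

lemma hom_dom_obj: "f \<in> hom C a b \<Longrightarrow> a \<in> Obj C"
  and hom_cod_obj: "f \<in> hom C a b \<Longrightarrow> b \<in> Obj C"
  using dom_obj cod_obj by (auto simp: hom_def)

lemma inverse_arrows_unique:
  assumes "inverse_arrows C f g" "inverse_arrows C f h"
  shows "g = h"
proof -
  obtain a b where f: "f \<in> hom C a b" and g: "g \<in> hom C b a"
    and gf: "g \<cdot>\<^bsub>C\<^esub> f = Ide C a" "f \<cdot>\<^bsub>C\<^esub> g = Ide C b"
    using assms(1) by (auto simp: inverse_arrows_def)
  obtain a' b' where f': "f \<in> hom C a' b'" and h': "h \<in> hom C b' a'"
    and hf': "h \<cdot>\<^bsub>C\<^esub> f = Ide C a'" "f \<cdot>\<^bsub>C\<^esub> h = Ide C b'"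
    using assms(2) by (auto simp: inverse_arrows_def)
  have [simp]: "a' = a" "b' = b"
    using f f' by (auto simp: hom_def)
  have h: "h \<in> hom C b a"
    using h' by simp
  have "g = (h \<cdot>\<^bsub>C\<^esub> f) \<cdot>\<^bsub>C\<^esub> g"
    using hf' g by (simp add: comp_ide_left)
  also have "\<dots> = h \<cdot>\<^bsub>C\<^esub> (f \<cdot>\<^bsub>C\<^esub> g)"
    using comp_assoc[OF g f h] .
  finally show ?thesis
    using gf h by (simp add: comp_ide_right)
qed

lemma inv_arr_inverse:
  assumes "is_iso C f"
  shows "inverse_arrows C f (inv_arr C f)"
proof -
  obtain g where g: "inverse_arrows C f g"
    using assms by (auto simp: is_iso_def)
  then have "inv_arr C f = g"
    unfolding inv_arr_def using inverse_arrows_unique by blast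
  then show ?thesis
    using g by simp
qed

lemma inv_arr_iso:
  assumes "is_iso C f" "f \<in> hom C a b"
  shows "inv_arr C f \<in> hom C b a"
    and "inv_arr C f \<cdot>\<^bsub>C\<^esub> f = Ide C a"
    and "f \<cdot>\<^bsub>C\<^esub> inv_arr C f = Ide C b"
  using inv_arr_inverse[OF assms(1)] assms(2) by (auto simp: inverse_arrows_def hom_def)

lemma inverse_arrows_ide: "a \<in> Obj C \<Longrightarrow> inverse_arrows C (Ide C a) (Ide C a)"
  using ide_hom comp_ide_left unfolding inverse_arrows_def by blast

lemma is_iso_ide: "a \<in> Obj C \<Longrightarrow> is_iso C (Ide C a)"
  using inverse_arrows_ide by (auto simp: is_iso_def)

lemma inv_arr_ide: "a \<in> Obj C \<Longrightarrow> inv_arr C (Ide C a) = Ide C a"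
  using inverse_arrows_unique inv_arr_inverse is_iso_ide inverse_arrows_ide by blast

lemma monicD:
  assumes "monic C m" "m \<in> hom C a b" "u \<in> hom C t a" "v \<in> hom C t a"
    "m \<cdot>\<^bsub>C\<^esub> u = m \<cdot>\<^bsub>C\<^esub> v"
  shows "u = v"
  using assms by (auto simp: monic_def hom_def)

lemma split_mono_monic:
  assumes m: "m \<in> hom C a b" and r: "r \<in> hom C b a" and rm: "r \<cdot>\<^bsub>C\<^esub> m = Ide C a"
  shows "monic C m"
  unfolding monic_def
proof (intro conjI allI ballI impI)
  show "m \<in> Arr C"
    using m by (simp add: hom_def)
  fix t u v
  assume "u \<in> hom C t (Dom C m)" "v \<in> hom C t (Dom C m)"
    and eq: "m \<cdot>\<^bsub>C\<^esub> u = m \<cdot>\<^bsub>C\<^esub> v"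
  then have uv: "u \<in> hom C t a" "v \<in> hom C t a"
    using m by (auto simp: hom_def)
  have cancel: "r \<cdot>\<^bsub>C\<^esub> (m \<cdot>\<^bsub>C\<^esub> w) = w" if w: "w \<in> hom C t a" for w
    by (simp only: comp_assoc[OF w m r, symmetric] rm comp_ide_left[OF w])
  show "u = v"
    using cancel[OF uv(1)] cancel[OF uv(2)] eq by metis
qed

lemma product_ex1:
  assumes "is_product C a b x p q" "u \<in> hom C t a" "v \<in> hom C t b"
  shows "\<exists>!w. w \<in> hom C t x \<and> p \<cdot>\<^bsub>C\<^esub> w = u \<and> q \<cdot>\<^bsub>C\<^esub> w = v"
  using assms by (simp add: is_product_def)

lemma product_eqI:
  assumes "is_product C a b x p q" "w \<in> hom C t x" "w' \<in> hom C t x"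
    "p \<cdot>\<^bsub>C\<^esub> w = p \<cdot>\<^bsub>C\<^esub> w'" "q \<cdot>\<^bsub>C\<^esub> w = q \<cdot>\<^bsub>C\<^esub> w'"
  shows "w = w'"
proof -
  have "p \<in> hom C x a" "q \<in> hom C x b"
    using assms(1) by (auto simp: is_product_def)
  then have "p \<cdot>\<^bsub>C\<^esub> w \<in> hom C t a" "q \<cdot>\<^bsub>C\<^esub> w \<in> hom C t b"
    using assms(2) comp_hom by blast+
  from product_ex1[OF assms(1) this] show ?thesis
    using assms(2-) by metis
qed

lemma tuple_product:
  assumes "is_product C a b x p q" "u \<in> hom C t a" "v \<in> hom C t b"
  shows "tuple C p q u v \<in> hom C t x"
    and "p \<cdot>\<^bsub>C\<^esub> tuple C p q u v = u" and "q \<cdot>\<^bsub>C\<^esub> tuple C p q u v = v"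
proof -
  have dom: "Dom C u = t" "Dom C p = x"
    using assms by (auto simp: is_product_def hom_def)
  show "tuple C p q u v \<in> hom C t x"
    and "p \<cdot>\<^bsub>C\<^esub> tuple C p q u v = u" and "q \<cdot>\<^bsub>C\<^esub> tuple C p q u v = v"
    using theI'[OF product_ex1[OF assms]] unfolding tuple_def dom by auto
qed

lemma product_comparison_iso:
  assumes P: "is_product C a b x p q" and W: "is_product C a b w r s"
  shows "is_iso C (tuple C r s p q)"
proof -
  have p: "p \<in> hom C x a" "q \<in> hom C x b" and r: "r \<in> hom C w a" "s \<in> hom C w b"
    using P W by (auto simp: is_product_def)
  let ?c = "tuple C r s p q" and ?d = "tuple C p q r s"
  note c = tuple_product[OF W p] and d = tuple_product[OF P r]
  have "?d \<cdot>\<^bsub>C\<^esub> ?c = Ide C x"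
  proof (rule product_eqI[OF P])
    show "?d \<cdot>\<^bsub>C\<^esub> ?c \<in> hom C x x"
      using c(1) d(1) comp_hom by blast
    show "Ide C x \<in> hom C x x"
      using p hom_dom_obj ide_hom by blast
    show "p \<cdot>\<^bsub>C\<^esub> ?d \<cdot>\<^bsub>C\<^esub> ?c = p \<cdot>\<^bsub>C\<^esub> Ide C x"
      using comp_assoc[OF c(1) d(1) p(1)] c(2) d(2) comp_ide_right[OF p(1)] by simp
    show "q \<cdot>\<^bsub>C\<^esub> ?d \<cdot>\<^bsub>C\<^esub> ?c = q \<cdot>\<^bsub>C\<^esub> Ide C x"
      using comp_assoc[OF c(1) d(1) p(2)] c(3) d(3) comp_ide_right[OF p(2)] by simp
  qed
  moreover have "?c \<cdot>\<^bsub>C\<^esub> ?d = Ide C w"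
  proof (rule product_eqI[OF W])
    show "?c \<cdot>\<^bsub>C\<^esub> ?d \<in> hom C w w"
      using c(1) d(1) comp_hom by blast
    show "Ide C w \<in> hom C w w"
      using r hom_dom_obj ide_hom by blast
    show "r \<cdot>\<^bsub>C\<^esub> ?c \<cdot>\<^bsub>C\<^esub> ?d = r \<cdot>\<^bsub>C\<^esub> Ide C w"
      using comp_assoc[OF d(1) c(1) r(1)] c(2) d(2) comp_ide_right[OF r(1)] by simp
    show "s \<cdot>\<^bsub>C\<^esub> ?c \<cdot>\<^bsub>C\<^esub> ?d = s \<cdot>\<^bsub>C\<^esub> Ide C w"
      using comp_assoc[OF d(1) c(1) r(2)] c(3) d(3) comp_ide_right[OF r(2)] by simp
  qed
  ultimately show ?thesis
    using c(1) d(1) unfolding is_iso_def inverse_arrows_def by blast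
qed

lemma is_equalizerD:
  assumes "is_equalizer C f g e" "e \<in> hom C k a"
  shows "f \<in> hom C a (Cod C f)" "g \<in> hom C a (Cod C f)" "f \<cdot>\<^bsub>C\<^esub> e = g \<cdot>\<^bsub>C\<^esub> e"
    and "u \<in> hom C t a \<Longrightarrow> f \<cdot>\<^bsub>C\<^esub> u = g \<cdot>\<^bsub>C\<^esub> u \<Longrightarrow> \<exists>!w. w \<in> hom C t k \<and> e \<cdot>\<^bsub>C\<^esub> w = u"
proof -
  obtain a' b k' where fg: "f \<in> hom C a' b" "g \<in> hom C a' b" "e \<in> hom C k' a'"
      "f \<cdot>\<^bsub>C\<^esub> e = g \<cdot>\<^bsub>C\<^esub> e"
    and univ: "\<And>t u. u \<in> hom C t a' \<Longrightarrow> f \<cdot>\<^bsub>C\<^esub> u = g \<cdot>\<^bsub>C\<^esub> u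
      \<Longrightarrow> \<exists>!w. w \<in> hom C t k' \<and> e \<cdot>\<^bsub>C\<^esub> w = u"
    using assms(1) unfolding is_equalizer_def by blast
  have eq: "a' = a" "k' = k" "b = Cod C f"
    using fg assms(2) by (auto simp: hom_def)
  show "f \<in> hom C a (Cod C f)" "g \<in> hom C a (Cod C f)" "f \<cdot>\<^bsub>C\<^esub> e = g \<cdot>\<^bsub>C\<^esub> e"
    using fg eq by auto
  show "u \<in> hom C t a \<Longrightarrow> f \<cdot>\<^bsub>C\<^esub> u = g \<cdot>\<^bsub>C\<^esub> u \<Longrightarrow> \<exists>!w. w \<in> hom C t k \<and> e \<cdot>\<^bsub>C\<^esub> w = u"
    using univ eq by simp
qed

lemma equalizer_monic:
  assumes "is_equalizer C f g e"
  shows "monic C e"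
proof -
  obtain k a where e: "e \<in> hom C k a"
    using assms by (auto simp: is_equalizer_def)
  note E = is_equalizerD[OF assms e]
  show ?thesis
    unfolding monic_def
  proof (intro conjI allI ballI impI)
    show "e \<in> Arr C"
      using e by (simp add: hom_def)
    fix t u v
    assume "u \<in> hom C t (Dom C e)" "v \<in> hom C t (Dom C e)"
      and eq: "e \<cdot>\<^bsub>C\<^esub> u = e \<cdot>\<^bsub>C\<^esub> v"
    then have uv: "u \<in> hom C t k" "v \<in> hom C t k"
      using e by (auto simp: hom_def)
    have "f \<cdot>\<^bsub>C\<^esub> (e \<cdot>\<^bsub>C\<^esub> u) = g \<cdot>\<^bsub>C\<^esub> (e \<cdot>\<^bsub>C\<^esub> u)"
      using comp_assoc[OF uv(1) e E(1)] comp_assoc[OF uv(1) e E(2)] E(3) by simp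
    from E(4)[OF comp_hom[OF uv(1) e] this] show "u = v"
      using uv eq by metis
  qed
qed

lemma equalizer_unique:
  assumes E: "is_equalizer C f g e" and E': "is_equalizer C f g e'"
    and e: "e \<in> hom C k a" and e': "e' \<in> hom C k' a"
  shows "\<exists>\<theta> \<in> hom C k' k. is_iso C \<theta> \<and> e \<cdot>\<^bsub>C\<^esub> \<theta> = e'"
proof -
  note D = is_equalizerD[OF E e] and D' = is_equalizerD[OF E' e']
  obtain s where s: "s \<in> hom C k' k" "e \<cdot>\<^bsub>C\<^esub> s = e'"
    using D(4)[OF e' D'(3)] by blast
  obtain r where r: "r \<in> hom C k k'" "e' \<cdot>\<^bsub>C\<^esub> r = e"
    using D'(4)[OF e D(3)] by blast
  have "s \<cdot>\<^bsub>C\<^esub> r = Ide C k"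
  proof (rule monicD[OF equalizer_monic[OF E] e])
    show "s \<cdot>\<^bsub>C\<^esub> r \<in> hom C k k" "Ide C k \<in> hom C k k"
      using s r comp_hom ide_hom hom_dom_obj by blast+
    show "e \<cdot>\<^bsub>C\<^esub> s \<cdot>\<^bsub>C\<^esub> r = e \<cdot>\<^bsub>C\<^esub> Ide C k"
      using comp_assoc[OF r(1) s(1) e] s r comp_ide_right[OF e] by simp
  qed
  moreover have "r \<cdot>\<^bsub>C\<^esub> s = Ide C k'"
  proof (rule monicD[OF equalizer_monic[OF E'] e'])
    show "r \<cdot>\<^bsub>C\<^esub> s \<in> hom C k' k'" "Ide C k' \<in> hom C k' k'"
      using s r comp_hom ide_hom hom_dom_obj by blast+
    show "e' \<cdot>\<^bsub>C\<^esub> r \<cdot>\<^bsub>C\<^esub> s = e' \<cdot>\<^bsub>C\<^esub> Ide C k'"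
      using comp_assoc[OF s(1) r(1) e'] s r comp_ide_right[OF e'] by simp
  qed
  ultimately show ?thesis
    using s r unfolding is_iso_def inverse_arrows_def by blast
qed

lemma is_pullbackD:
  assumes "is_pullback C f g p q"
  shows "f \<in> hom C (Cod C p) (Cod C f)" "g \<in> hom C (Cod C q) (Cod C f)"
    "p \<in> hom C (Dom C p) (Cod C p)" "q \<in> hom C (Dom C p) (Cod C q)" "f \<cdot>\<^bsub>C\<^esub> p = g \<cdot>\<^bsub>C\<^esub> q"
    and "u \<in> hom C t (Cod C p) \<Longrightarrow> v \<in> hom C t (Cod C q) \<Longrightarrow> f \<cdot>\<^bsub>C\<^esub> u = g \<cdot>\<^bsub>C\<^esub> v
      \<Longrightarrow> \<exists>!w. w \<in> hom C t (Dom C p) \<and> p \<cdot>\<^bsub>C\<^esub> w = u \<and> q \<cdot>\<^bsub>C\<^esub> w = v"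
proof -
  obtain a b c x where fg: "f \<in> hom C a c" "g \<in> hom C b c" "p \<in> hom C x a" "q \<in> hom C x b"
      "f \<cdot>\<^bsub>C\<^esub> p = g \<cdot>\<^bsub>C\<^esub> q"
    and univ: "\<And>t u v. u \<in> hom C t a \<Longrightarrow> v \<in> hom C t b \<Longrightarrow> f \<cdot>\<^bsub>C\<^esub> u = g \<cdot>\<^bsub>C\<^esub> v
      \<Longrightarrow> \<exists>!w. w \<in> hom C t x \<and> p \<cdot>\<^bsub>C\<^esub> w = u \<and> q \<cdot>\<^bsub>C\<^esub> w = v"
    using assms unfolding is_pullback_def by blast
  have eq: "a = Cod C p" "b = Cod C q" "c = Cod C f" "x = Dom C p"
    using fg by (auto simp: hom_def)
  show "f \<in> hom C (Cod C p) (Cod C f)" "g \<in> hom C (Cod C q) (Cod C f)"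
    "p \<in> hom C (Dom C p) (Cod C p)" "q \<in> hom C (Dom C p) (Cod C q)" "f \<cdot>\<^bsub>C\<^esub> p = g \<cdot>\<^bsub>C\<^esub> q"
    using fg eq by auto
  show "u \<in> hom C t (Cod C p) \<Longrightarrow> v \<in> hom C t (Cod C q) \<Longrightarrow> f \<cdot>\<^bsub>C\<^esub> u = g \<cdot>\<^bsub>C\<^esub> v
      \<Longrightarrow> \<exists>!w. w \<in> hom C t (Dom C p) \<and> p \<cdot>\<^bsub>C\<^esub> w = u \<and> q \<cdot>\<^bsub>C\<^esub> w = v"
    using univ eq by simp
qed

text \<open>
  Pasting: an arrow \<open>u\<close> into the domain of \<open>d\<close> equalizes \<open>f \<cdot> d\<close> and \<open>g \<cdot> d\<close> exactly when \<open>d \<cdot> u\<close>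
  factors through the equalizer of \<open>f\<close> and \<open>g\<close>, and the pullback represents such arrows.
\<close>

lemma equalizer_pullback:
  assumes E: "is_equalizer C f g e" and P: "is_pullback C d e p q"
  shows "is_equalizer C (f \<cdot>\<^bsub>C\<^esub> d) (g \<cdot>\<^bsub>C\<^esub> d) p"
proof -
  let ?a = "Cod C p" and ?k = "Cod C q" and ?x = "Dom C p" and ?c = "Cod C d" and ?b = "Cod C f"
  note pb = is_pullbackD[OF P]
  note eq = is_equalizerD[OF E pb(2)]
  have fd: "f \<cdot>\<^bsub>C\<^esub> d \<in> hom C ?a ?b" "g \<cdot>\<^bsub>C\<^esub> d \<in> hom C ?a ?b"
    using eq pb comp_hom by blast+
  have "(f \<cdot>\<^bsub>C\<^esub> d) \<cdot>\<^bsub>C\<^esub> p = (f \<cdot>\<^bsub>C\<^esub> e) \<cdot>\<^bsub>C\<^esub> q"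
    using comp_assoc[OF pb(3) pb(1) eq(1)] comp_assoc[OF pb(4) pb(2) eq(1)] pb(5) by simp
  also have "\<dots> = (g \<cdot>\<^bsub>C\<^esub> d) \<cdot>\<^bsub>C\<^esub> p"
    using comp_assoc[OF pb(3) pb(1) eq(2)] comp_assoc[OF pb(4) pb(2) eq(2)] pb(5) eq(3) by simp
  finally have fork: "(f \<cdot>\<^bsub>C\<^esub> d) \<cdot>\<^bsub>C\<^esub> p = (g \<cdot>\<^bsub>C\<^esub> d) \<cdot>\<^bsub>C\<^esub> p" .
  have "\<exists>!w. w \<in> hom C t ?x \<and> p \<cdot>\<^bsub>C\<^esub> w = u"
    if u: "u \<in> hom C t ?a" and fgu: "(f \<cdot>\<^bsub>C\<^esub> d) \<cdot>\<^bsub>C\<^esub> u = (g \<cdot>\<^bsub>C\<^esub> d) \<cdot>\<^bsub>C\<^esub> u" for t u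
  proof -
    have "f \<cdot>\<^bsub>C\<^esub> (d \<cdot>\<^bsub>C\<^esub> u) = g \<cdot>\<^bsub>C\<^esub> (d \<cdot>\<^bsub>C\<^esub> u)"
      using comp_assoc[OF u pb(1) eq(1)] comp_assoc[OF u pb(1) eq(2)] fgu by simp
    from eq(4)[OF comp_hom[OF u pb(1)] this]
    obtain v where v: "v \<in> hom C t ?k" "e \<cdot>\<^bsub>C\<^esub> v = d \<cdot>\<^bsub>C\<^esub> u"
      by blast
    obtain w where w: "w \<in> hom C t ?x" "p \<cdot>\<^bsub>C\<^esub> w = u" "q \<cdot>\<^bsub>C\<^esub> w = v"
      using pb(6)[OF u v(1)] v(2) by metis
    have "w' = w" if w': "w' \<in> hom C t ?x" "p \<cdot>\<^bsub>C\<^esub> w' = u" for w'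
    proof -
      have "e \<cdot>\<^bsub>C\<^esub> (q \<cdot>\<^bsub>C\<^esub> w') = d \<cdot>\<^bsub>C\<^esub> u"
        using comp_assoc[OF w'(1) pb(4) pb(2)] comp_assoc[OF w'(1) pb(3) pb(1)] pb(5) w'(2) by simp
      then have "q \<cdot>\<^bsub>C\<^esub> w' = v"
        using v by (intro monicD[OF equalizer_monic[OF E] pb(2) comp_hom[OF w'(1) pb(4)]]) auto
      then show ?thesis
        using pb(6)[OF u v(1)] v(2) w w' by metis
    qed
    then show ?thesis
      using w by blast
  qed
  then show ?thesis
    unfolding is_equalizer_def using fd pb(3) fork by blast
qed

end


section \<open>Categories of structured objects\<close>

text \<open>
  Both coalgebras and PDEs are objects with an underlying object of the base category, and their
  arrows are those arrows of the base that respect a structure. An arrow carries its source and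
  target since the underlying arrow does not determine them.
\<close>

definition structured_cat :: "('o, 'a) cat \<Rightarrow> ('x \<Rightarrow> bool) \<Rightarrow> ('x \<Rightarrow> 'o)
    \<Rightarrow> ('x \<Rightarrow> 'a \<Rightarrow> 'x \<Rightarrow> bool) \<Rightarrow> ('x, 'x \<times> 'a \<times> 'x) cat" where
  "structured_cat C ob U S = \<lparr>
     Obj = {X. ob X},
     Arr = {(X, \<phi>, Y). ob X \<and> ob Y \<and> \<phi> \<in> hom C (U X) (U Y) \<and> S X \<phi> Y},
     Dom = (\<lambda>(X, \<phi>, Y). X),
     Cod = (\<lambda>(X, \<phi>, Y). Y),
     Ide = (\<lambda>X. (X, Ide C (U X), X)),
     Comp = (\<lambda>(Y', \<psi>, Z) (X, \<phi>, Y). (X, \<psi> \<cdot>\<^bsub>C\<^esub> \<phi>, Z))\<rparr>"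

lemma hom_structured_cat:
  "m \<in> hom (structured_cat C ob U S) X Y \<longleftrightarrow>
     (\<exists>\<phi>. m = (X, \<phi>, Y) \<and> ob X \<and> ob Y \<and> \<phi> \<in> hom C (U X) (U Y) \<and> S X \<phi> Y)"
  by (cases m) (auto simp: hom_def structured_cat_def)

lemma comp_structured_cat [simp]:
  "(Y', \<psi>, Z) \<cdot>\<^bsub>structured_cat C ob U S\<^esub> (X, \<phi>, Y) = (X, \<psi> \<cdot>\<^bsub>C\<^esub> \<phi>, Z)"
  by (simp add: structured_cat_def)

text \<open>
  A limit cone of underlying objects lifts as soon as it is an initial source: an arrow into its
  vertex respects the structure whenever its composites with the legs do.
\<close>

lemma (in category) structured_product:
  assumes P: "is_product C (U a) (U b) (U x) p q"
    and ob: "ob a" "ob b" "ob x" and S: "S x p a" "S x q b"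
    and initial: "\<And>t \<phi>. ob t \<Longrightarrow> \<phi> \<in> hom C (U t) (U x) \<Longrightarrow> S t (p \<cdot>\<^bsub>C\<^esub> \<phi>) a \<Longrightarrow> S t (q \<cdot>\<^bsub>C\<^esub> \<phi>) b
      \<Longrightarrow> S t \<phi> x"
  shows "is_product (structured_cat C ob U S) a b x (x, p, a) (x, q, b)"
proof -
  let ?D = "structured_cat C ob U S"
  have "\<exists>!w. w \<in> hom ?D t x \<and> (x, p, a) \<cdot>\<^bsub>?D\<^esub> w = u \<and> (x, q, b) \<cdot>\<^bsub>?D\<^esub> w = v"
    if uv: "u \<in> hom ?D t a" "v \<in> hom ?D t b" for t u v
  proof -
    obtain \<phi> \<psi> where \<phi>: "u = (t, \<phi>, a)" "\<phi> \<in> hom C (U t) (U a)" "S t \<phi> a"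
      and \<psi>: "v = (t, \<psi>, b)" "\<psi> \<in> hom C (U t) (U b)" "S t \<psi> b" and t: "ob t"
      using uv by (auto simp: hom_structured_cat)
    obtain \<chi> where \<chi>: "\<chi> \<in> hom C (U t) (U x)" "p \<cdot>\<^bsub>C\<^esub> \<chi> = \<phi>" "q \<cdot>\<^bsub>C\<^esub> \<chi> = \<psi>"
      using product_ex1[OF P \<phi>(2) \<psi>(2)] by blast
    have unique: "w = \<chi>" if "w \<in> hom C (U t) (U x)" "p \<cdot>\<^bsub>C\<^esub> w = \<phi>" "q \<cdot>\<^bsub>C\<^esub> w = \<psi>" for w
      using product_eqI[OF P that(1) \<chi>(1)] that \<chi> by simp
    show ?thesis
    proof (rule ex1I[of _ "(t, \<chi>, x)"])
      show "(t, \<chi>, x) \<in> hom ?D t x \<and> (x, p, a) \<cdot>\<^bsub>?D\<^esub> (t, \<chi>, x) = u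
          \<and> (x, q, b) \<cdot>\<^bsub>?D\<^esub> (t, \<chi>, x) = v"
        using \<chi> \<phi> \<psi> t ob initial by (simp add: hom_structured_cat)
      show "w = (t, \<chi>, x)" if "w \<in> hom ?D t x \<and> (x, p, a) \<cdot>\<^bsub>?D\<^esub> w = u
          \<and> (x, q, b) \<cdot>\<^bsub>?D\<^esub> w = v" for w
        using that \<phi>(1) \<psi>(1) unique by (auto simp: hom_structured_cat)
    qed
  qed
  moreover have "p \<in> hom C (U x) (U a)" "q \<in> hom C (U x) (U b)"
    using P by (auto simp: is_product_def)
  ultimately show ?thesis
    using ob S unfolding is_product_def by (auto simp: hom_structured_cat)
qed

lemma (in category) structured_equalizer:
  assumes E: "is_equalizer C f g e" and e: "e \<in> hom C (U k) (U a)" and f: "f \<in> hom C (U a) (U b)"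
    and ob: "ob a" "ob b" "ob k" and S: "S a f b" "S a g b" "S k e a"
    and initial: "\<And>t \<phi>. ob t \<Longrightarrow> \<phi> \<in> hom C (U t) (U k) \<Longrightarrow> S t (e \<cdot>\<^bsub>C\<^esub> \<phi>) a \<Longrightarrow> S t \<phi> k"
  shows "is_equalizer (structured_cat C ob U S) (a, f, b) (a, g, b) (k, e, a)"
proof -
  let ?D = "structured_cat C ob U S"
  note D = is_equalizerD[OF E e]
  have g: "g \<in> hom C (U a) (U b)"
    using D(1,2) f by (auto simp: hom_def)
  have "\<exists>!w. w \<in> hom ?D t k \<and> (k, e, a) \<cdot>\<^bsub>?D\<^esub> w = u"
    if u: "u \<in> hom ?D t a" and fork: "(a, f, b) \<cdot>\<^bsub>?D\<^esub> u = (a, g, b) \<cdot>\<^bsub>?D\<^esub> u" for t u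
  proof -
    obtain \<phi> where \<phi>: "u = (t, \<phi>, a)" "\<phi> \<in> hom C (U t) (U a)" "S t \<phi> a" and t: "ob t"
      using u by (auto simp: hom_structured_cat)
    have "f \<cdot>\<^bsub>C\<^esub> \<phi> = g \<cdot>\<^bsub>C\<^esub> \<phi>"
      using fork \<phi>(1) by simp
    from D(4)[OF \<phi>(2) this] obtain \<chi> where \<chi>: "\<chi> \<in> hom C (U t) (U k)" "e \<cdot>\<^bsub>C\<^esub> \<chi> = \<phi>"
      by blast
    have unique: "w = \<chi>" if "w \<in> hom C (U t) (U k)" "e \<cdot>\<^bsub>C\<^esub> w = \<phi>" for w
      using monicD[OF equalizer_monic[OF E] e that(1) \<chi>(1)] that \<chi> by simp
    show ?thesis
    proof (rule ex1I[of _ "(t, \<chi>, k)"])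
      show "(t, \<chi>, k) \<in> hom ?D t k \<and> (k, e, a) \<cdot>\<^bsub>?D\<^esub> (t, \<chi>, k) = u"
        using \<chi> \<phi> t ob initial by (simp add: hom_structured_cat)
      show "w = (t, \<chi>, k)" if "w \<in> hom ?D t k \<and> (k, e, a) \<cdot>\<^bsub>?D\<^esub> w = u" for w
        using that \<phi>(1) unique by (auto simp: hom_structured_cat)
    qed
  qed
  then show ?thesis
    unfolding is_equalizer_def using f g e ob S D(3)
    by (intro exI[of _ a] exI[of _ b] exI[of _ k]) (auto simp: hom_structured_cat)
qed

lemma (in category) category_structured_cat:
  assumes U: "\<And>X. ob X \<Longrightarrow> U X \<in> Obj C"
    and ide: "\<And>X. ob X \<Longrightarrow> S X (Ide C (U X)) X"
    and comp: "\<And>X Y Z \<phi> \<psi>. ob X \<Longrightarrow> ob Y \<Longrightarrow> ob Z \<Longrightarrow> \<phi> \<in> hom C (U X) (U Y) \<Longrightarrow> \<psi> \<in> hom C (U Y) (U Z)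
      \<Longrightarrow> S X \<phi> Y \<Longrightarrow> S Y \<psi> Z \<Longrightarrow> S X (\<psi> \<cdot>\<^bsub>C\<^esub> \<phi>) Z"
  shows "category (structured_cat C ob U S)"
proof -
  let ?D = "structured_cat C ob U S"
  have ide_D: "Ide ?D X = (X, Ide C (U X), X)" for X
    by (simp add: structured_cat_def)
  show ?thesis
  proof
    show "Dom ?D f \<in> Obj ?D" "Cod ?D f \<in> Obj ?D" if "f \<in> Arr ?D" for f
      using that by (auto simp: structured_cat_def)
    show "Ide ?D X \<in> hom ?D X X" if "X \<in> Obj ?D" for X
      using that U ide ide_hom by (auto simp: structured_cat_def hom_def)
    show "g \<cdot>\<^bsub>?D\<^esub> f \<in> hom ?D a c" if "f \<in> hom ?D a b" "g \<in> hom ?D b c" for f g a b c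
      using that comp comp_hom by (auto simp: hom_structured_cat)
    show "f \<cdot>\<^bsub>?D\<^esub> Ide ?D a = f" "Ide ?D b \<cdot>\<^bsub>?D\<^esub> f = f" if "f \<in> hom ?D a b" for f a b
      using that comp_ide_left comp_ide_right by (auto simp: hom_structured_cat ide_D)
    show "(h \<cdot>\<^bsub>?D\<^esub> g) \<cdot>\<^bsub>?D\<^esub> f = h \<cdot>\<^bsub>?D\<^esub> g \<cdot>\<^bsub>?D\<^esub> f"
      if "f \<in> hom ?D a b" "g \<in> hom ?D b c" "h \<in> hom ?D c d" for f g h a b c d
      using that comp_assoc by (auto simp: hom_structured_cat)
  qed
qed


section \<open>Right adjoints\<close>

context adjunction
begin

abbreviation "Lf \<equiv> farr (left_adj A)"
abbreviation "Rf \<equiv> farr (right_adj A)"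
abbreviation "Lo \<equiv> fobj (left_adj A)"
abbreviation "Ro \<equiv> fobj (right_adj A)"

text \<open>Transposition, from \<open>L a \<rightarrow> x\<close> to \<open>a \<rightarrow> R x\<close> and back.\<close>

definition sharp where "sharp a u = Rf u \<cdot>\<^bsub>C\<^esub> adj_unit A a"
definition flat where "flat x v = adj_counit A x \<cdot>\<^bsub>D\<^esub> Lf v"

lemma unit_hom: "a \<in> Obj C \<Longrightarrow> adj_unit A a \<in> hom C a (Ro (Lo a))"
  and unit_natural: "f \<in> hom C a b \<Longrightarrow> adj_unit A b \<cdot>\<^bsub>C\<^esub> f = Rf (Lf f) \<cdot>\<^bsub>C\<^esub> adj_unit A a"
  using unit_nat by (simp_all add: nat_trans_def ftr_id_def ftr_comp_def)

lemma counit_hom: "x \<in> Obj D \<Longrightarrow> adj_counit A x \<in> hom D (Lo (Ro x)) x"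
  and counit_natural: "f \<in> hom D x y \<Longrightarrow> adj_counit A y \<cdot>\<^bsub>D\<^esub> Lf (Rf f) = f \<cdot>\<^bsub>D\<^esub> adj_counit A x"
  using counit_nat by (simp_all add: nat_trans_def ftr_id_def ftr_comp_def)

lemma sharp_hom:
  assumes "a \<in> Obj C" "u \<in> hom D (Lo a) x"
  shows "sharp a u \<in> hom C a (Ro x)"
  unfolding sharp_def using assms unit_hom R.map_hom L.src.comp_hom by blast

lemma flat_hom:
  assumes "x \<in> Obj D" "v \<in> hom C a (Ro x)"
  shows "flat x v \<in> hom D (Lo a) x"
  unfolding flat_def using assms counit_hom L.map_hom L.tgt.comp_hom by blast

lemma sharp_flat:
  assumes x: "x \<in> Obj D" and v: "v \<in> hom C a (Ro x)"
  shows "sharp a (flat x v) = v"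
proof -
  have a: "a \<in> Obj C"
    using v L.src.hom_dom_obj by blast
  note Lv = L.map_hom[OF v] and RLv = R.map_hom[OF L.map_hom[OF v]] and \<epsilon> = counit_hom[OF x]
  have Rx: "Ro x \<in> Obj C"
    using x by (rule R.map_obj)
  have "sharp a (flat x v) = (Rf (adj_counit A x) \<cdot>\<^bsub>C\<^esub> Rf (Lf v)) \<cdot>\<^bsub>C\<^esub> adj_unit A a"
    using R.map_comp[OF Lv \<epsilon>] by (simp add: sharp_def flat_def)
  also have "\<dots> = Rf (adj_counit A x) \<cdot>\<^bsub>C\<^esub> (adj_unit A (Ro x) \<cdot>\<^bsub>C\<^esub> v)"
    using L.src.comp_assoc[OF unit_hom[OF a] RLv R.map_hom[OF \<epsilon>]] unit_natural[OF v] by simp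
  also have "\<dots> = v"
    using L.src.comp_assoc[OF v unit_hom[OF Rx] R.map_hom[OF \<epsilon>]] triangle_right[OF x]
      L.src.comp_ide_left[OF v] by simp
  finally show ?thesis .
qed

lemma flat_sharp:
  assumes a: "a \<in> Obj C" and u: "u \<in> hom D (Lo a) x"
  shows "flat x (sharp a u) = u"
proof -
  have x: "x \<in> Obj D"
    using u L.tgt.hom_cod_obj by blast
  note Ru = R.map_hom[OF u] and LRu = L.map_hom[OF R.map_hom[OF u]] and \<eta> = unit_hom[OF a]
  have La: "Lo a \<in> Obj D"
    using a by (rule L.map_obj)
  have "flat x (sharp a u) = adj_counit A x \<cdot>\<^bsub>D\<^esub> (Lf (Rf u) \<cdot>\<^bsub>D\<^esub> Lf (adj_unit A a))"
    using L.map_comp[OF \<eta> Ru] by (simp add: sharp_def flat_def)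
  also have "\<dots> = (u \<cdot>\<^bsub>D\<^esub> adj_counit A (Lo a)) \<cdot>\<^bsub>D\<^esub> Lf (adj_unit A a)"
    using L.tgt.comp_assoc[OF L.map_hom[OF \<eta>] LRu counit_hom[OF x]] counit_natural[OF u] by simp
  also have "\<dots> = u"
    using L.tgt.comp_assoc[OF L.map_hom[OF \<eta>] counit_hom[OF La] u] triangle_left[OF a]
      L.tgt.comp_ide_right[OF u] by simp
  finally show ?thesis .
qed

lemma sharp_natural:
  assumes a: "a \<in> Obj C" and u: "u \<in> hom D (Lo a) x" and p: "p \<in> hom D x y"
  shows "sharp a (p \<cdot>\<^bsub>D\<^esub> u) = Rf p \<cdot>\<^bsub>C\<^esub> sharp a u"
  using R.map_comp[OF u p] L.src.comp_assoc[OF unit_hom[OF a] R.map_hom[OF u] R.map_hom[OF p]]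
  by (simp add: sharp_def)

lemma flat_natural:
  assumes v: "v \<in> hom C a (Ro x)" and p: "p \<in> hom D x y"
  shows "flat y (Rf p \<cdot>\<^bsub>C\<^esub> v) = p \<cdot>\<^bsub>D\<^esub> flat x v"
proof -
  have a: "a \<in> Obj C" and x: "x \<in> Obj D" and y: "y \<in> Obj D"
    using v p L.src.hom_dom_obj L.tgt.hom_dom_obj L.tgt.hom_cod_obj by blast+
  have u: "flat x v \<in> hom D (Lo a) x"
    using x v by (rule flat_hom)
  have "flat y (Rf p \<cdot>\<^bsub>C\<^esub> v) = flat y (sharp a (p \<cdot>\<^bsub>D\<^esub> flat x v))"
    using sharp_natural[OF a u p] sharp_flat[OF x v] by simp
  also have "\<dots> = p \<cdot>\<^bsub>D\<^esub> flat x v"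
    using flat_sharp[OF a L.tgt.comp_hom[OF u p]] .
  finally show ?thesis .
qed

lemma right_adj_monic:
  assumes M: "monic D m"
  shows "monic C (Rf m)"
proof -
  obtain x y where m: "m \<in> hom D x y"
    using M by (auto simp: monic_def hom_def)
  have xy: "x \<in> Obj D" "y \<in> Obj D"
    using m L.tgt.hom_dom_obj L.tgt.hom_cod_obj by blast+
  note Rm = R.map_hom[OF m]
  show ?thesis
    unfolding monic_def
  proof (intro conjI allI ballI impI)
    show "Rf m \<in> Arr C"
      using Rm by (simp add: hom_def)
    fix t u v
    assume "u \<in> hom C t (Dom C (Rf m))" "v \<in> hom C t (Dom C (Rf m))"
      and eq: "Rf m \<cdot>\<^bsub>C\<^esub> u = Rf m \<cdot>\<^bsub>C\<^esub> v"
    then have uv: "u \<in> hom C t (Ro x)" "v \<in> hom C t (Ro x)"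
      using Rm by (auto simp: hom_def)
    have "m \<cdot>\<^bsub>D\<^esub> flat x u = m \<cdot>\<^bsub>D\<^esub> flat x v"
      using flat_natural[OF uv(1) m] flat_natural[OF uv(2) m] eq by simp
    then have "flat x u = flat x v"
      using L.tgt.monicD[OF M m] flat_hom[OF xy(1)] uv by blast
    then show "u = v"
      using sharp_flat[OF xy(1)] uv by metis
  qed
qed

lemma right_adj_product:
  assumes P: "is_product D a b x p q"
  shows "is_product C (Ro a) (Ro b) (Ro x) (Rf p) (Rf q)"
proof -
  have pq: "p \<in> hom D x a" "q \<in> hom D x b"
    using P by (auto simp: is_product_def)
  have ob: "a \<in> Obj D" "b \<in> Obj D" "x \<in> Obj D"
    using pq L.tgt.hom_dom_obj L.tgt.hom_cod_obj by blast+
  have "\<exists>!w. w \<in> hom C t (Ro x) \<and> Rf p \<cdot>\<^bsub>C\<^esub> w = u \<and> Rf q \<cdot>\<^bsub>C\<^esub> w = v"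
    if u: "u \<in> hom C t (Ro a)" and v: "v \<in> hom C t (Ro b)" for t u v
  proof -
    have t: "t \<in> Obj C"
      using u L.src.hom_dom_obj by blast
    obtain w where w: "w \<in> hom D (Lo t) x" "p \<cdot>\<^bsub>D\<^esub> w = flat a u" "q \<cdot>\<^bsub>D\<^esub> w = flat b v"
      using L.tgt.product_ex1[OF P flat_hom[OF ob(1) u] flat_hom[OF ob(2) v]] by blast
    show ?thesis
    proof (rule ex1I[of _ "sharp t w"])
      show "sharp t w \<in> hom C t (Ro x) \<and> Rf p \<cdot>\<^bsub>C\<^esub> sharp t w = u \<and> Rf q \<cdot>\<^bsub>C\<^esub> sharp t w = v"
        using sharp_hom[OF t w(1)] sharp_natural[OF t w(1) pq(1)] sharp_natural[OF t w(1) pq(2)]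
          sharp_flat[OF ob(1) u] sharp_flat[OF ob(2) v] w by simp
      show "w' = sharp t w"
        if w': "w' \<in> hom C t (Ro x) \<and> Rf p \<cdot>\<^bsub>C\<^esub> w' = u \<and> Rf q \<cdot>\<^bsub>C\<^esub> w' = v" for w'
      proof -
        have w'_hom: "w' \<in> hom C t (Ro x)"
          using w' by simp
        have "flat x w' = w"
          using L.tgt.product_eqI[OF P flat_hom[OF ob(3) w'_hom] w(1)] flat_natural[OF w'_hom pq(1)]
            flat_natural[OF w'_hom pq(2)] w' w(2,3) by simp
        then show ?thesis
          using sharp_flat[OF ob(3) w'_hom] by simp
      qed
    qed
  qed
  then show ?thesis
    unfolding is_product_def using pq R.map_hom by blast
qed

lemma right_adj_equalizer:
  assumes E: "is_equalizer D f g e"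
  shows "is_equalizer C (Rf f) (Rf g) (Rf e)"
proof -
  obtain k a where e: "e \<in> hom D k a"
    using E by (auto simp: is_equalizer_def)
  note D = L.tgt.is_equalizerD[OF E e]
  have ob: "k \<in> Obj D" "a \<in> Obj D"
    using e L.tgt.hom_dom_obj L.tgt.hom_cod_obj by blast+
  have fork: "Rf f \<cdot>\<^bsub>C\<^esub> Rf e = Rf g \<cdot>\<^bsub>C\<^esub> Rf e"
    using R.map_comp[OF e D(1)] R.map_comp[OF e D(2)] D(3) by simp
  have "\<exists>!w. w \<in> hom C t (Ro k) \<and> Rf e \<cdot>\<^bsub>C\<^esub> w = u"
    if u: "u \<in> hom C t (Ro a)" and fgu: "Rf f \<cdot>\<^bsub>C\<^esub> u = Rf g \<cdot>\<^bsub>C\<^esub> u" for t u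
  proof -
    have t: "t \<in> Obj C"
      using u L.src.hom_dom_obj by blast
    have "f \<cdot>\<^bsub>D\<^esub> flat a u = g \<cdot>\<^bsub>D\<^esub> flat a u"
      using flat_natural[OF u D(1)] flat_natural[OF u D(2)] fgu by simp
    from D(4)[OF flat_hom[OF ob(2) u] this]
    obtain w where w: "w \<in> hom D (Lo t) k" "e \<cdot>\<^bsub>D\<^esub> w = flat a u"
      by blast
    have "Rf e \<cdot>\<^bsub>C\<^esub> sharp t w = u"
      using sharp_natural[OF t w(1) e] sharp_flat[OF ob(2) u] w(2) by simp
    moreover have "w' = w''"
      if "w' \<in> hom C t (Ro k)" "w'' \<in> hom C t (Ro k)" "Rf e \<cdot>\<^bsub>C\<^esub> w' = Rf e \<cdot>\<^bsub>C\<^esub> w''" for w' w''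
      using L.src.monicD[OF right_adj_monic[OF L.tgt.equalizer_monic[OF E]] R.map_hom[OF e]] that
      by blast
    ultimately show ?thesis
      using sharp_hom[OF t w(1)] by metis
  qed
  then show ?thesis
    unfolding is_equalizer_def using R.map_hom[OF D(1)] R.map_hom[OF D(2)] R.map_hom[OF e] fork
    by blast
qed

end

section \<open>The jet comonad\<close>

text \<open>
  The functors \<open>f\<^sub>! \<stileturn> f\<^sup>* \<stileturn> f\<^sub>*\<close> of a base change triple, viewed abstractly: being both a right and a
  left adjoint, the middle one induces the monad \<open>T = f\<^sup>* f\<^sub>!\<close> and, adjoint to it, the comonad
  \<open>J = f\<^sup>* f\<^sub>*\<close>.
\<close>

locale adjoint_triple =
  base: category "base B" +
  sum: adjunction "base B" "total B" "sum_adj B" +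
  prd: adjunction "total B" "base B" "prod_adj B"
  for B :: "('o, 'a, 'p, 'b) adj_triple" +
  assumes middle: "right_adj (sum_adj B) = left_adj (prod_adj B)"
begin

abbreviation cmp :: "'a \<Rightarrow> 'a \<Rightarrow> 'a" (infixr \<open>\<odot>\<close> 70) where
  "g \<odot> f \<equiv> g \<cdot>\<^bsub>base B\<^esub> f"
abbreviation hm :: "'o \<Rightarrow> 'o \<Rightarrow> 'a set" where
  "hm \<equiv> hom (base B)"
abbreviation J :: "'o \<Rightarrow> 'o" where
  "J \<equiv> fobj (jet B)"
abbreviation Jm :: "'a \<Rightarrow> 'a" where
  "Jm \<equiv> farr (jet B)"
abbreviation T :: "'o \<Rightarrow> 'o" where
  "T \<equiv> fobj (disk B)"
abbreviation \<epsilon> :: "'o \<Rightarrow> 'a" where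
  "\<epsilon> \<equiv> jet_counit B"
abbreviation \<Delta> :: "'o \<Rightarrow> 'a" where
  "\<Delta> \<equiv> jet_coprod B"
abbreviation \<eta> :: "'o \<Rightarrow> 'a" where
  "\<eta> \<equiv> disk_unit B"

lemmas comp_homs = base.comp_hom
lemmas assoc = base.comp_assoc

lemma jet_obj: "Y \<in> Obj (base B) \<Longrightarrow> J Y \<in> Obj (base B)"
  using prd.R.map_obj prd.L.map_obj by (simp add: jet_def ftr_comp_def)

lemma jet_hom: "f \<in> hm X Y \<Longrightarrow> Jm f \<in> hm (J X) (J Y)"
  using prd.R.map_hom prd.L.map_hom by (simp add: jet_def ftr_comp_def)

lemma jet_comp: "f \<in> hm X Y \<Longrightarrow> g \<in> hm Y Z \<Longrightarrow> Jm (g \<odot> f) = Jm g \<odot> Jm f"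
  using prd.R.map_comp prd.L.map_comp prd.R.map_hom
  by (simp add: jet_def ftr_comp_def) blast

lemma counit_hom: "Y \<in> Obj (base B) \<Longrightarrow> \<epsilon> Y \<in> hm (J Y) Y"
  using prd.counit_hom by (simp add: jet_def ftr_comp_def jet_counit_def)

lemma counit_natural: "f \<in> hm X Y \<Longrightarrow> \<epsilon> Y \<odot> Jm f = f \<odot> \<epsilon> X"
  using prd.counit_natural by (simp add: jet_def ftr_comp_def jet_counit_def)

lemma coprod_hom: "Y \<in> Obj (base B) \<Longrightarrow> \<Delta> Y \<in> hm (J Y) (J (J Y))"
  using prd.L.map_hom prd.unit_hom prd.R.map_obj by (simp add: jet_def ftr_comp_def jet_coprod_def)

lemma coprod_natural:
  assumes f: "f \<in> hm X Y"
  shows "\<Delta> Y \<odot> Jm f = Jm (Jm f) \<odot> \<Delta> X"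
proof -
  note Rf = prd.R.map_hom[OF f]
  have ob: "prd.Ro X \<in> Obj (total B)" "prd.Ro Y \<in> Obj (total B)"
    using f base.hom_dom_obj base.hom_cod_obj prd.R.map_obj by blast+
  note u = prd.unit_hom[OF ob(1)] prd.unit_hom[OF ob(2)]
  have "\<Delta> Y \<odot> Jm f = prd.Lf (adj_unit (prod_adj B) (prd.Ro Y) \<cdot>\<^bsub>total B\<^esub> prd.Rf f)"
    using prd.L.map_comp[OF Rf u(2)] by (simp add: jet_def ftr_comp_def jet_coprod_def)
  also have "\<dots> = Jm (Jm f) \<odot> \<Delta> X"
    using prd.L.map_comp[OF u(1) prd.R.map_hom[OF prd.L.map_hom[OF Rf]]] prd.unit_natural[OF Rf]
    by (simp add: jet_def ftr_comp_def jet_coprod_def)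
  finally show ?thesis .
qed

lemma counit_coprod: "Y \<in> Obj (base B) \<Longrightarrow> \<epsilon> (J Y) \<odot> \<Delta> Y = Ide (base B) (J Y)"
  using prd.triangle_left prd.R.map_obj
  by (simp add: jet_def ftr_comp_def jet_coprod_def jet_counit_def)

lemma coprod_coassoc:
  assumes Y: "Y \<in> Obj (base B)"
  shows "\<Delta> (J Y) \<odot> \<Delta> Y = Jm (\<Delta> Y) \<odot> \<Delta> Y"
proof -
  let ?u = "adj_unit (prod_adj B)"
  have RY: "prd.Ro Y \<in> Obj (total B)" "prd.Ro (J Y) \<in> Obj (total B)"
    using Y jet_obj prd.R.map_obj by blast+
  note u = prd.unit_hom[OF RY(1)] and u' = prd.unit_hom[OF RY(2)]
  have u2: "?u (prd.Ro Y) \<in> hom (total B) (prd.Ro Y) (prd.Ro (J Y))"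
    using u by (simp add: jet_def ftr_comp_def)
  have "\<Delta> (J Y) \<odot> \<Delta> Y = prd.Lf (?u (prd.Ro (J Y)) \<cdot>\<^bsub>total B\<^esub> ?u (prd.Ro Y))"
    using prd.L.map_comp[OF u2 u'] by (simp add: jet_coprod_def)
  also have "\<dots> = Jm (\<Delta> Y) \<odot> \<Delta> Y"
    using prd.unit_natural[OF u2] prd.L.map_comp[OF u prd.R.map_hom[OF prd.L.map_hom[OF u]]]
    by (simp add: jet_def ftr_comp_def jet_coprod_def)
  finally show ?thesis .
qed

text \<open>
  As \<open>f\<^sup>*\<close> is right adjoint to \<open>f\<^sub>!\<close>, the comonad \<open>J = f\<^sup>* f\<^sub>*\<close> is a composite of two right adjoints.
  This is where the left half of the triple enters, and why limits of coalgebras are computed on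
  underlying objects.
\<close>

lemma jet_monic: "monic (base B) m \<Longrightarrow> monic (base B) (Jm m)"
  using sum.right_adj_monic[OF prd.right_adj_monic] by (simp add: jet_def ftr_comp_def middle)

lemma jet_product:
  "is_product (base B) a b x p q \<Longrightarrow> is_product (base B) (J a) (J b) (J x) (Jm p) (Jm q)"
  using sum.right_adj_product[OF prd.right_adj_product] by (simp add: jet_def ftr_comp_def middle)

lemma jet_equalizer:
  "is_equalizer (base B) f g e \<Longrightarrow> is_equalizer (base B) (Jm f) (Jm g) (Jm e)"
  using sum.right_adj_equalizer[OF prd.right_adj_equalizer]
  by (simp add: jet_def ftr_comp_def middle)

text \<open>The passage to adjuncts under \<open>T \<stileturn> J\<close> is transposition along \<open>f\<^sup>* \<stileturn> f\<^sub>*\<close> followed by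
  transposition along \<open>f\<^sub>! \<stileturn> f\<^sup>*\<close>.\<close>

lemma adjunct_sharp: "adjunct B A s = sum.sharp A (prd.sharp (sum.Lo A) s)"
  by (simp add: adjunct_def sum.sharp_def prd.sharp_def)

lemma disk_eq: "T A = prd.Lo (sum.Lo A)"
  by (simp add: disk_def ftr_comp_def middle)

lemma jet_eq: "J Y = sum.Ro (prd.Ro Y)" "Jm f = sum.Rf (prd.Rf f)"
  by (simp_all add: jet_def ftr_comp_def middle)

lemma adjunct_hom:
  assumes "A \<in> Obj (base B)" "s \<in> hm (T A) Y"
  shows "adjunct B A s \<in> hm A (J Y)"
  using assms sum.sharp_hom prd.sharp_hom sum.L.map_obj by (simp add: adjunct_sharp disk_eq jet_eq)

lemma adjunct_natural:
  assumes A: "A \<in> Obj (base B)" and s: "s \<in> hm (T A) Y" and p: "p \<in> hm Y Z"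
  shows "adjunct B A (p \<odot> s) = Jm p \<odot> adjunct B A s"
proof -
  have LA: "sum.Lo A \<in> Obj (total B)"
    using A by (rule sum.L.map_obj)
  note s' = s[unfolded disk_eq]
  show ?thesis
    unfolding adjunct_sharp jet_eq prd.sharp_natural[OF LA s' p]
    using sum.sharp_natural[OF A prd.sharp_hom[OF LA s'] prd.R.map_hom[OF p]] .
qed

lemma adjunct_surj:
  assumes h: "h \<in> hm A (J Y)" and Y: "Y \<in> Obj (base B)"
  shows "\<exists>s \<in> hm (T A) Y. adjunct B A s = h"
proof -
  have RY: "prd.Ro Y \<in> Obj (total B)"
    using Y by (rule prd.R.map_obj)
  note h' = h[unfolded jet_eq]
  note v = sum.flat_hom[OF RY h']
  have "prd.flat Y (sum.flat (prd.Ro Y) h) \<in> hm (T A) Y"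
    unfolding disk_eq using prd.flat_hom[OF Y v] .
  moreover have "adjunct B A (prd.flat Y (sum.flat (prd.Ro Y) h)) = h"
    unfolding adjunct_sharp prd.sharp_flat[OF Y v] sum.sharp_flat[OF RY h'] ..
  ultimately show ?thesis
    by blast
qed

lemma disk_unit_hom: "A \<in> Obj (base B) \<Longrightarrow> \<eta> A \<in> hm A (T A)"
  using sum.unit_hom by (simp add: disk_unit_def disk_def ftr_comp_def)

text \<open>The unit of the monad \<open>T\<close> and the counit of the comonad \<open>J\<close> are mates.\<close>

lemma counit_adjunct:
  assumes A: "A \<in> Obj (base B)" and s: "s \<in> hm (T A) Y"
  shows "\<epsilon> Y \<odot> adjunct B A s = s \<odot> \<eta> A"
proof -
  have LA: "sum.Lo A \<in> Obj (total B)"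
    using A by (rule sum.L.map_obj)
  have Y: "Y \<in> Obj (base B)"
    using s base.hom_cod_obj by blast
  note s' = s[unfolded disk_eq]
  note t = prd.sharp_hom[OF LA s']
  have \<eta>: "\<eta> A \<in> hm A (sum.Ro (sum.Lo A))"
    using disk_unit_hom[OF A] by (simp add: disk_eq middle)
  have "\<epsilon> Y \<odot> adjunct B A s
      = adj_counit (prod_adj B) Y \<odot> (prd.Lf (prd.sharp (sum.Lo A) s) \<odot> \<eta> A)"
    by (simp add: jet_counit_def adjunct_sharp sum.sharp_def[of A] disk_unit_def middle)
  also have "\<dots> = prd.flat Y (prd.sharp (sum.Lo A) s) \<odot> \<eta> A"
    using assoc[OF _ prd.L.map_hom[OF t] prd.counit_hom[OF Y]] \<eta> by (simp add: prd.flat_def middle)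
  also have "\<dots> = s \<odot> \<eta> A"
    using prd.flat_sharp[OF LA s'] by simp
  finally show ?thesis .
qed

end

section \<open>Coalgebras of the jet comonad\<close>

context adjoint_triple
begin

lemma coalgebraD:
  assumes "coalgebra B (E, \<rho>)"
  shows "E \<in> Obj (base B)" "\<rho> \<in> hm E (J E)" "\<epsilon> E \<odot> \<rho> = Ide (base B) E"
    "Jm \<rho> \<odot> \<rho> = \<Delta> E \<odot> \<rho>"
  using assms by (auto simp: coalgebra_def)

lemma coalgebra_cofree: "Y \<in> Obj (base B) \<Longrightarrow> coalgebra B (cofree B Y)"
  by (simp add: coalgebra_def cofree_def jet_obj coprod_hom counit_coprod coprod_coassoc)

abbreviation coalgebra_map :: "'o \<times> 'a \<Rightarrow> 'a \<Rightarrow> 'o \<times> 'a \<Rightarrow> bool" where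
  "coalgebra_map X \<phi> Y \<equiv> snd Y \<odot> \<phi> = Jm \<phi> \<odot> snd X"

lemma EM_structured: "EM B = structured_cat (base B) (coalgebra B) fst coalgebra_map"
  by (simp add: EM_def structured_cat_def)

text \<open>
  Compatibility with counit and coproduct is an equation between arrows into \<open>K\<close> and into \<open>J (J K)\<close>.
  For an arrow \<open>\<phi> : K \<rightarrow> E\<close> to a coalgebra that commutes with the candidate coaction, they hold after
  composition with \<open>\<phi>\<close>, respectively \<open>J (J \<phi>)\<close>; it remains to cancel a (jointly) monic family of such arrows.
\<close>

lemma coalgebra_map_counit:
  assumes E: "coalgebra B (E, \<rho>)" and \<phi>: "\<phi> \<in> hm K E" and \<kappa>: "\<kappa> \<in> hm K (J K)"
    and eq: "Jm \<phi> \<odot> \<kappa> = \<rho> \<odot> \<phi>"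
  shows "\<phi> \<odot> (\<epsilon> K \<odot> \<kappa>) = \<phi>"
proof -
  note D = coalgebraD[OF E]
  have K: "K \<in> Obj (base B)"
    using \<phi> base.hom_dom_obj by blast
  note \<epsilon>K = counit_hom[OF K] and \<epsilon>E = counit_hom[OF D(1)]
  have "\<phi> \<odot> (\<epsilon> K \<odot> \<kappa>) = (\<epsilon> E \<odot> Jm \<phi>) \<odot> \<kappa>"
    unfolding counit_natural[OF \<phi>] assoc[OF \<kappa> \<epsilon>K \<phi>] ..
  also have "\<dots> = (\<epsilon> E \<odot> \<rho>) \<odot> \<phi>"
    unfolding assoc[OF \<kappa> jet_hom[OF \<phi>] \<epsilon>E] assoc[OF \<phi> D(2) \<epsilon>E] eq ..
  also have "\<dots> = \<phi>"
    unfolding D(3) base.comp_ide_left[OF \<phi>] ..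
  finally show ?thesis .
qed

lemma coalgebra_map_coassoc:
  assumes E: "coalgebra B (E, \<rho>)" and \<phi>: "\<phi> \<in> hm K E" and \<kappa>: "\<kappa> \<in> hm K (J K)"
    and eq: "Jm \<phi> \<odot> \<kappa> = \<rho> \<odot> \<phi>"
  shows "Jm (Jm \<phi>) \<odot> (Jm \<kappa> \<odot> \<kappa>) = Jm (Jm \<phi>) \<odot> (\<Delta> K \<odot> \<kappa>)"
proof -
  note D = coalgebraD[OF E]
  have K: "K \<in> Obj (base B)"
    using \<phi> base.hom_dom_obj by blast
  note J\<phi> = jet_hom[OF \<phi>] and J\<kappa> = jet_hom[OF \<kappa>] and J\<rho> = jet_hom[OF D(2)]
  note JJ\<phi> = jet_hom[OF J\<phi>] and \<Delta>K = coprod_hom[OF K] and \<Delta>E = coprod_hom[OF D(1)]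
  have "Jm (Jm \<phi>) \<odot> (Jm \<kappa> \<odot> \<kappa>) = Jm (Jm \<phi> \<odot> \<kappa>) \<odot> \<kappa>"
    unfolding assoc[OF \<kappa> J\<kappa> JJ\<phi>, symmetric] jet_comp[OF \<kappa> J\<phi>] ..
  also have "\<dots> = Jm \<rho> \<odot> (Jm \<phi> \<odot> \<kappa>)"
    unfolding eq jet_comp[OF \<phi> D(2)] assoc[OF \<kappa> J\<phi> J\<rho>] ..
  also have "\<dots> = (Jm \<rho> \<odot> \<rho>) \<odot> \<phi>"
    unfolding eq assoc[OF \<phi> D(2) J\<rho>] ..
  also have "\<dots> = \<Delta> E \<odot> (Jm \<phi> \<odot> \<kappa>)"
    unfolding D(4) eq assoc[OF \<phi> D(2) \<Delta>E] ..
  also have "\<dots> = Jm (Jm \<phi>) \<odot> (\<Delta> K \<odot> \<kappa>)"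
    unfolding assoc[OF \<kappa> J\<phi> \<Delta>E, symmetric] coprod_natural[OF \<phi>] assoc[OF \<kappa> \<Delta>K JJ\<phi>] ..
  finally show ?thesis .
qed

lemma subcoalgebra:
  assumes E: "coalgebra B (E, \<rho>)" and e: "e \<in> hm K E" "monic (base B) e"
    and \<kappa>: "\<kappa> \<in> hm K (J K)" and eq: "Jm e \<odot> \<kappa> = \<rho> \<odot> e"
  shows "coalgebra B (K, \<kappa>)"
proof -
  have K: "K \<in> Obj (base B)"
    using e base.hom_dom_obj by blast
  have "\<epsilon> K \<odot> \<kappa> = Ide (base B) K"
    using base.monicD[OF e(2,1) comp_homs[OF \<kappa> counit_hom[OF K]] base.ide_hom[OF K]]
      coalgebra_map_counit[OF E e(1) \<kappa> eq] base.comp_ide_right[OF e(1)] by simp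
  moreover have "Jm \<kappa> \<odot> \<kappa> = \<Delta> K \<odot> \<kappa>"
    using base.monicD[OF jet_monic[OF jet_monic[OF e(2)]] jet_hom[OF jet_hom[OF e(1)]]
        comp_homs[OF \<kappa> jet_hom[OF \<kappa>]] comp_homs[OF \<kappa> coprod_hom[OF K]]
        coalgebra_map_coassoc[OF E e(1) \<kappa> eq]] .
  ultimately show ?thesis
    using K \<kappa> by (simp add: coalgebra_def)
qed

lemma product_coalgebra:
  assumes E: "coalgebra B (E, \<rho>E)" and F: "coalgebra B (F, \<rho>F)"
    and P: "is_product (base B) E F X \<pi>1 \<pi>2"
    and \<rho>: "\<rho> \<in> hm X (J X)" and eq: "Jm \<pi>1 \<odot> \<rho> = \<rho>E \<odot> \<pi>1" "Jm \<pi>2 \<odot> \<rho> = \<rho>F \<odot> \<pi>2"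
  shows "coalgebra B (X, \<rho>)"
proof -
  have \<pi>: "\<pi>1 \<in> hm X E" "\<pi>2 \<in> hm X F"
    using P by (auto simp: is_product_def)
  have X: "X \<in> Obj (base B)"
    using \<pi> base.hom_dom_obj by blast
  have "\<epsilon> X \<odot> \<rho> = Ide (base B) X"
    using base.product_eqI[OF P comp_homs[OF \<rho> counit_hom[OF X]] base.ide_hom[OF X]]
      coalgebra_map_counit[OF E \<pi>(1) \<rho> eq(1)] coalgebra_map_counit[OF F \<pi>(2) \<rho> eq(2)]
      base.comp_ide_right[OF \<pi>(1)] base.comp_ide_right[OF \<pi>(2)] by simp
  moreover have "Jm \<rho> \<odot> \<rho> = \<Delta> X \<odot> \<rho>"
    using base.product_eqI[OF jet_product[OF jet_product[OF P]]
        comp_homs[OF \<rho> jet_hom[OF \<rho>]] comp_homs[OF \<rho> coprod_hom[OF X]]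
        coalgebra_map_coassoc[OF E \<pi>(1) \<rho> eq(1)] coalgebra_map_coassoc[OF F \<pi>(2) \<rho> eq(2)]] .
  ultimately show ?thesis
    using X \<rho> by (simp add: coalgebra_def)
qed

text \<open>
  The coalgebra maps out of a limit cone reflect coalgebra maps: if \<open>\<psi>\<close> and \<open>\<psi> \<odot> \<phi>\<close> are compatible with
  the coactions, then the square for \<open>\<phi>\<close> commutes after composition with \<open>J \<psi>\<close>, and it remains to cancel
  a (jointly) monic family of such arrows \<open>J \<psi>\<close>.
\<close>

lemma coalgebra_map_cancel:
  assumes \<tau>: "\<tau> \<in> hm A (J A)" and \<kappa>: "\<kappa> \<in> hm K (J K)" and \<rho>: "\<rho> \<in> hm E (J E)"
    and \<phi>: "\<phi> \<in> hm A K" and \<psi>: "\<psi> \<in> hm K E"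
    and eq: "\<rho> \<odot> \<psi> = Jm \<psi> \<odot> \<kappa>" "\<rho> \<odot> (\<psi> \<odot> \<phi>) = Jm (\<psi> \<odot> \<phi>) \<odot> \<tau>"
  shows "Jm \<psi> \<odot> (\<kappa> \<odot> \<phi>) = Jm \<psi> \<odot> (Jm \<phi> \<odot> \<tau>)"
proof -
  have "Jm \<psi> \<odot> (\<kappa> \<odot> \<phi>) = \<rho> \<odot> (\<psi> \<odot> \<phi>)"
    unfolding assoc[OF \<phi> \<kappa> jet_hom[OF \<psi>], symmetric] assoc[OF \<phi> \<psi> \<rho>, symmetric] eq(1) ..
  also have "\<dots> = Jm \<psi> \<odot> (Jm \<phi> \<odot> \<tau>)"
    unfolding eq(2) jet_comp[OF \<phi> \<psi>] assoc[OF \<tau> jet_hom[OF \<phi>] jet_hom[OF \<psi>]] ..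
  finally show ?thesis .
qed

lemma monic_coalgebra_map_initial:
  assumes "coalgebra B (A, \<tau>)" "coalgebra B (K, \<kappa>)" "coalgebra B (E, \<rho>)"
    and \<phi>: "\<phi> \<in> hm A K" and e: "e \<in> hm K E" "monic (base B) e"
    and eq: "\<rho> \<odot> e = Jm e \<odot> \<kappa>" "\<rho> \<odot> (e \<odot> \<phi>) = Jm (e \<odot> \<phi>) \<odot> \<tau>"
  shows "\<kappa> \<odot> \<phi> = Jm \<phi> \<odot> \<tau>"
proof -
  note h = coalgebraD(2)[OF assms(1)] coalgebraD(2)[OF assms(2)] coalgebraD(2)[OF assms(3)]
  show ?thesis
    using base.monicD[OF jet_monic[OF e(2)] jet_hom[OF e(1)] comp_homs[OF \<phi> h(2)]
        comp_homs[OF h(1) jet_hom[OF \<phi>]] coalgebra_map_cancel[OF h \<phi> e(1) eq]] .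
qed

lemma product_coalgebra_map_initial:
  assumes "coalgebra B (A, \<tau>)" "coalgebra B (X, \<rho>)" "coalgebra B (E, \<rho>E)" "coalgebra B (F, \<rho>F)"
    and \<phi>: "\<phi> \<in> hm A X" and P: "is_product (base B) E F X \<pi>1 \<pi>2"
    and eq1: "\<rho>E \<odot> \<pi>1 = Jm \<pi>1 \<odot> \<rho>" "\<rho>E \<odot> (\<pi>1 \<odot> \<phi>) = Jm (\<pi>1 \<odot> \<phi>) \<odot> \<tau>"
    and eq2: "\<rho>F \<odot> \<pi>2 = Jm \<pi>2 \<odot> \<rho>" "\<rho>F \<odot> (\<pi>2 \<odot> \<phi>) = Jm (\<pi>2 \<odot> \<phi>) \<odot> \<tau>"
  shows "\<rho> \<odot> \<phi> = Jm \<phi> \<odot> \<tau>"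
proof -
  note h = coalgebraD(2)[OF assms(1)] coalgebraD(2)[OF assms(2)]
  note hE = coalgebraD(2)[OF assms(3)] and hF = coalgebraD(2)[OF assms(4)]
  have \<pi>: "\<pi>1 \<in> hm X E" "\<pi>2 \<in> hm X F"
    using P by (auto simp: is_product_def)
  show ?thesis
    using base.product_eqI[OF jet_product[OF P] comp_homs[OF \<phi> h(2)]
        comp_homs[OF h(1) jet_hom[OF \<phi>]] coalgebra_map_cancel[OF h hE \<phi> \<pi>(1) eq1]
        coalgebra_map_cancel[OF h hF \<phi> \<pi>(2) eq2]] .
qed

text \<open>The coaction on an equalizer is forced: \<open>J\<close> preserves the equalizer, so that \<open>\<rho> \<odot> e\<close> factors
  uniquely through \<open>J e\<close>.\<close>

lemma equalizer_coalgebra_ex1: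
  assumes E: "coalgebra B (E, \<rho>E)" and F: "coalgebra B (F, \<rho>F)"
    and f: "f \<in> hm E F" "\<rho>F \<odot> f = Jm f \<odot> \<rho>E" and g: "g \<in> hm E F" "\<rho>F \<odot> g = Jm g \<odot> \<rho>E"
    and Eq: "is_equalizer (base B) f g e" and e: "e \<in> hm K E"
  shows "\<exists>!\<kappa>. coalgebra B (K, \<kappa>) \<and> \<rho>E \<odot> e = Jm e \<odot> \<kappa>"
proof -
  note DE = coalgebraD[OF E] and DF = coalgebraD[OF F]
  note mono = base.equalizer_monic[OF Eq]
  note Je = jet_hom[OF e]
  have "Jm f \<odot> (\<rho>E \<odot> e) = \<rho>F \<odot> (f \<odot> e)"
    unfolding assoc[OF e DE(2) jet_hom[OF f(1)], symmetric] assoc[OF e f(1) DF(2), symmetric] f(2) ..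
  also have "\<dots> = \<rho>F \<odot> (g \<odot> e)"
    using base.is_equalizerD(3)[OF Eq e] by simp
  also have "\<dots> = Jm g \<odot> (\<rho>E \<odot> e)"
    unfolding assoc[OF e DE(2) jet_hom[OF g(1)], symmetric] assoc[OF e g(1) DF(2), symmetric] g(2) ..
  finally have "Jm f \<odot> (\<rho>E \<odot> e) = Jm g \<odot> (\<rho>E \<odot> e)" .
  from base.is_equalizerD(4)[OF jet_equalizer[OF Eq] Je comp_homs[OF e DE(2)] this]
  obtain \<kappa> where \<kappa>: "\<kappa> \<in> hm K (J K)" "Jm e \<odot> \<kappa> = \<rho>E \<odot> e"
    by blast
  show ?thesis
  proof (rule ex1I[of _ \<kappa>])
    show "coalgebra B (K, \<kappa>) \<and> \<rho>E \<odot> e = Jm e \<odot> \<kappa>"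
      using subcoalgebra[OF E e mono \<kappa>] \<kappa>(2) by simp
    fix \<kappa>'
    assume \<kappa>': "coalgebra B (K, \<kappa>') \<and> \<rho>E \<odot> e = Jm e \<odot> \<kappa>'"
    then have "\<kappa>' \<in> hm K (J K)"
      using coalgebraD by blast
    then show "\<kappa>' = \<kappa>"
      using base.monicD[OF jet_monic[OF mono] Je _ \<kappa>(1)] \<kappa>' \<kappa>(2) by simp
  qed
qed


section \<open>Formally integrable PDEs as coalgebras\<close>

text \<open>
  For a formally integrable \<open>m : E \<rightarrow> J Y\<close> the transported coaction makes \<open>m\<close> a map to the cofree
  coalgebra. Since \<open>J m\<close> is monic this determines the coaction, and since \<open>m\<close> and \<open>J (J m)\<close> are monic
  the coalgebra laws are inherited from \<open>J Y\<close>.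
\<close>

lemma presented_byD:
  assumes "presented_by B P (E, \<rho>)"
  shows "generalized_pde B P \<and> formally_integrable B P" "pde_carrier B P = E"
    "fst P \<in> Obj (base B)" "snd P \<in> hm E (J (fst P))" "monic (base B) (snd P)"
    "coalgebra B (E, \<rho>)" "Jm (snd P) \<odot> \<rho> = \<Delta> (fst P) \<odot> snd P"
proof -
  let ?Y = "fst P" and ?m = "snd P"
  show pde: "generalized_pde B P \<and> formally_integrable B P" and E: "pde_carrier B P = E"
    using assms by (auto simp: presented_by_def PDE_def)
  then show Y: "?Y \<in> Obj (base B)" and m: "?m \<in> hm E (J ?Y)" and mono: "monic (base B) ?m"
    by (auto simp: generalized_pde_def)
  obtain e \<rho>0 where pb: "is_pullback (base B) (\<Delta> ?Y) (Jm ?m) e \<rho>0"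
    and iso: "is_iso (base B) (\<epsilon> E \<odot> \<rho>0)" and \<rho>: "\<rho> = \<rho>0 \<odot> inv_arr (base B) (\<epsilon> E \<odot> \<rho>0)"
    using assms E by (auto simp: presented_by_def prolongation_def canonical_inclusion_def)
  note Jm = jet_hom[OF m] and \<Delta> = coprod_hom[OF Y]
  have EO: "E \<in> Obj (base B)"
    using m base.hom_dom_obj by blast
  note D = base.is_pullbackD[OF pb]
  have cod: "Cod (base B) e = J ?Y" "Cod (base B) \<rho>0 = J E"
    using D(1,2) Jm \<Delta> by (auto simp: hom_def)
  define x where "x = Dom (base B) e"
  have e: "e \<in> hm x (J ?Y)" and \<rho>0: "\<rho>0 \<in> hm x (J E)"
    using D(3,4) cod by (auto simp: x_def)
  note \<epsilon>E = counit_hom[OF EO] and \<epsilon>JY = counit_hom[OF jet_obj[OF Y]]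
  note \<iota> = comp_homs[OF \<rho>0 \<epsilon>E]
  note inv = base.inv_arr_iso[OF iso \<iota>]
  have \<rho>h: "\<rho> \<in> hm E (J E)"
    unfolding \<rho> using comp_homs[OF inv(1) \<rho>0] .
  have "e = (\<epsilon> (J ?Y) \<odot> \<Delta> ?Y) \<odot> e"
    unfolding counit_coprod[OF Y] base.comp_ide_left[OF e] ..
  also have "\<dots> = (\<epsilon> (J ?Y) \<odot> Jm ?m) \<odot> \<rho>0"
    unfolding assoc[OF e \<Delta> \<epsilon>JY] assoc[OF \<rho>0 Jm \<epsilon>JY] D(5) ..
  also have "\<dots> = ?m \<odot> (\<epsilon> E \<odot> \<rho>0)"
    unfolding counit_natural[OF m] assoc[OF \<rho>0 \<epsilon>E m] ..
  finally have e_eq: "?m \<odot> (\<epsilon> E \<odot> \<rho>0) = e"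
    by simp
  let ?i = "inv_arr (base B) (\<epsilon> E \<odot> \<rho>0)"
  have m_eq: "e \<odot> ?i = ?m"
    unfolding e_eq[symmetric] assoc[OF inv(1) \<iota> m] inv(3) base.comp_ide_right[OF m] ..
  have "Jm ?m \<odot> \<rho> = (\<Delta> ?Y \<odot> e) \<odot> ?i"
    unfolding \<rho> D(5) assoc[OF inv(1) \<rho>0 Jm] ..
  also have "\<dots> = \<Delta> ?Y \<odot> ?m"
    unfolding assoc[OF inv(1) e \<Delta>] m_eq ..
  finally show eq: "Jm ?m \<odot> \<rho> = \<Delta> ?Y \<odot> ?m" .
  show "coalgebra B (E, \<rho>)"
    using subcoalgebra[OF coalgebra_cofree[OF Y, unfolded cofree_def] m mono \<rho>h eq] .
qed

text \<open>
  Conversely, a subcoalgebra \<open>m\<close> of a cofree coalgebra is its own prolongation, that is, the square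
  \<open>\<Delta> \<odot> m = J m \<odot> \<rho>\<close> is a pullback. The first component of a competing cone \<open>(u, v)\<close> factors as
  \<open>u = m \<odot> (\<epsilon> \<odot> v)\<close>, by applying the counit to \<open>\<Delta> \<odot> u = J m \<odot> v\<close>, and then
  \<open>v = \<rho> \<odot> (\<epsilon> \<odot> v)\<close> since \<open>J m\<close> is monic.
\<close>

lemma subcoalgebra_presented_by:
  assumes E: "coalgebra B (E, \<rho>)" and Y: "Y \<in> Obj (base B)"
    and m: "m \<in> hm E (J Y)" and mono: "monic (base B) m" and eq: "Jm m \<odot> \<rho> = \<Delta> Y \<odot> m"
  shows "presented_by B (Y, m) (E, \<rho>)"
proof -
  note D = coalgebraD[OF E] and Jm = jet_hom[OF m] and \<Delta> = coprod_hom[OF Y]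
  note \<epsilon>E = counit_hom[OF D(1)] and \<epsilon>JY = counit_hom[OF jet_obj[OF Y]]
  have carrier: "pde_carrier B (Y, m) = E"
    using m by (simp add: pde_carrier_def hom_def)
  have "\<exists>!w. w \<in> hm t E \<and> m \<odot> w = u \<and> \<rho> \<odot> w = v"
    if u: "u \<in> hm t (J Y)" and v: "v \<in> hm t (J E)" and uv: "\<Delta> Y \<odot> u = Jm m \<odot> v" for t u v
  proof -
    note w = comp_homs[OF v \<epsilon>E]
    have "u = (\<epsilon> (J Y) \<odot> \<Delta> Y) \<odot> u"
      unfolding counit_coprod[OF Y] base.comp_ide_left[OF u] ..
    also have "\<dots> = (\<epsilon> (J Y) \<odot> Jm m) \<odot> v"
      unfolding assoc[OF u \<Delta> \<epsilon>JY] assoc[OF v Jm \<epsilon>JY] uv ..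
    also have "\<dots> = m \<odot> (\<epsilon> E \<odot> v)"
      unfolding counit_natural[OF m] assoc[OF v \<epsilon>E m] ..
    finally have mw: "m \<odot> (\<epsilon> E \<odot> v) = u"
      by simp
    have "Jm m \<odot> (\<rho> \<odot> (\<epsilon> E \<odot> v)) = \<Delta> Y \<odot> u"
      unfolding assoc[OF w D(2) Jm, symmetric] eq assoc[OF w m \<Delta>] mw ..
    then have \<rho>w: "\<rho> \<odot> (\<epsilon> E \<odot> v) = v"
      using base.monicD[OF jet_monic[OF mono] Jm comp_homs[OF w D(2)] v] uv by simp
    show ?thesis
    proof (rule ex1I[of _ "\<epsilon> E \<odot> v"])
      show "\<epsilon> E \<odot> v \<in> hm t E \<and> m \<odot> (\<epsilon> E \<odot> v) = u \<and> \<rho> \<odot> (\<epsilon> E \<odot> v) = v"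
        using w mw \<rho>w by blast
      show "w' = \<epsilon> E \<odot> v" if "w' \<in> hm t E \<and> m \<odot> w' = u \<and> \<rho> \<odot> w' = v" for w'
        using base.monicD[OF mono m _ w] that mw by simp
    qed
  qed
  then have pro: "prolongation B (Y, m) m \<rho>"
    unfolding prolongation_def is_pullback_def fst_conv snd_conv
    using Jm \<Delta> m D(2) eq[symmetric] by blast
  have inc: "canonical_inclusion B (Y, m) \<rho> = Ide (base B) E"
    unfolding canonical_inclusion_def carrier D(3) ..
  have iso: "is_iso (base B) (canonical_inclusion B (Y, m) \<rho>)"
    unfolding inc using base.is_iso_ide[OF D(1)] .
  have "\<rho> = \<rho> \<odot> inv_arr (base B) (canonical_inclusion B (Y, m) \<rho>)"
    unfolding inc base.inv_arr_ide[OF D(1)] base.comp_ide_right[OF D(2)] ..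
  then have coaction: "\<exists>e \<rho>'. prolongation B (Y, m) e \<rho>'
      \<and> is_iso (base B) (canonical_inclusion B (Y, m) \<rho>')
      \<and> \<rho> = \<rho>' \<odot> inv_arr (base B) (canonical_inclusion B (Y, m) \<rho>')"
    using pro iso by blast
  have "formally_integrable B (Y, m)"
    unfolding formally_integrable_def using pro iso by blast
  moreover have "generalized_pde B (Y, m)"
    unfolding generalized_pde_def carrier using Y m mono by simp
  ultimately show ?thesis
    unfolding presented_by_def carrier using coaction by (simp add: PDE_def)
qed

lemma coalgebra_presented_by_coaction:
  assumes E: "coalgebra B (E, \<rho>)"
  shows "presented_by B (pde_of_coalgebra (E, \<rho>)) (E, \<rho>)"
proof -
  note D = coalgebraD[OF E]
  show ?thesis
    using subcoalgebra_presented_by[OF E D(1) D(2)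
        base.split_mono_monic[OF D(2) counit_hom[OF D(1)] D(3)] D(4)]
    by (simp add: pde_of_coalgebra_def)
qed

text \<open>
  Cancelling \<open>J m\<close>, where \<open>m = snd P\<close>, the condition on a family of formal solutions becomes intrinsic to the
  coalgebra: the map \<open>s : T A \<rightarrow> E\<close> is determined by its restriction along \<open>\<eta> A\<close>, as the transpose of
  the coaction on it.
\<close>

lemma formal_solutions_iff:
  assumes P: "presented_by B P (E, \<rho>)" and A: "A \<in> Obj (base B)" and s: "s \<in> hm (T A) E"
  shows "s \<in> formal_solutions B P A \<longleftrightarrow> \<rho> \<odot> (s \<odot> \<eta> A) = adjunct B A s"
proof -
  let ?m = "snd P" and ?Y = "fst P"
  note D = presented_byD[OF P]
  note C = coalgebraD[OF D(6)] and Jm = jet_hom[OF D(4)] and \<eta> = disk_unit_hom[OF A]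
  note s\<eta> = comp_homs[OF \<eta> s]
  have "\<Delta> ?Y \<odot> ((?m \<odot> s) \<odot> \<eta> A) = Jm ?m \<odot> (\<rho> \<odot> (s \<odot> \<eta> A))"
    unfolding assoc[OF \<eta> s D(4)] assoc[OF s\<eta> D(4) coprod_hom[OF D(3)], symmetric]
      D(7)[symmetric] assoc[OF s\<eta> C(2) Jm] ..
  moreover have "adjunct B A (?m \<odot> s) = Jm ?m \<odot> adjunct B A s"
    using adjunct_natural[OF A s D(4)] .
  moreover have "Jm ?m \<odot> (\<rho> \<odot> (s \<odot> \<eta> A)) = Jm ?m \<odot> adjunct B A s
      \<longleftrightarrow> \<rho> \<odot> (s \<odot> \<eta> A) = adjunct B A s"
    using base.monicD[OF jet_monic[OF D(5)] Jm comp_homs[OF s\<eta> C(2)] adjunct_hom[OF A s]] by auto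
  ultimately show ?thesis
    using s D(2) by (simp add: formal_solutions_def)
qed

lemma formal_solutions_hom:
  "presented_by B P (E, \<rho>) \<Longrightarrow> s \<in> formal_solutions B P A \<Longrightarrow> s \<in> hm (T A) E"
  using presented_byD(2) by (auto simp: formal_solutions_def)

text \<open>
  A coalgebra map preserves solutions by naturality of adjuncts. Conversely, the transpose
  \<open>s : T E \<rightarrow> E\<close> of the coaction is the universal family of solutions, with \<open>s \<odot> \<eta> E\<close> the identity;
  that \<open>\<phi> \<odot> s\<close> is a family of solutions says exactly that \<open>\<phi>\<close> is a coalgebra map.
\<close>

lemma preserves_solutions_iff:
  assumes P: "presented_by B P (E, \<rho>)" and Q: "presented_by B Q (F, \<rho>')" and \<phi>: "\<phi> \<in> hm E F"
  shows "(\<forall>A \<in> Obj (base B). \<forall>s \<in> formal_solutions B P A. \<phi> \<odot> s \<in> formal_solutions B Q A)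
    \<longleftrightarrow> \<rho>' \<odot> \<phi> = Jm \<phi> \<odot> \<rho>"
proof -
  note C = coalgebraD[OF presented_byD(6)[OF P]] and C' = coalgebraD[OF presented_byD(6)[OF Q]]
  note J\<phi> = jet_hom[OF \<phi>]
  have Q_iff: "\<phi> \<odot> s \<in> formal_solutions B Q A
      \<longleftrightarrow> (\<rho>' \<odot> \<phi>) \<odot> (s \<odot> \<eta> A) = Jm \<phi> \<odot> adjunct B A s"
    if A: "A \<in> Obj (base B)" and s: "s \<in> hm (T A) E" for A s
  proof -
    note \<eta> = disk_unit_hom[OF A]
    show ?thesis
      unfolding formal_solutions_iff[OF Q A comp_homs[OF s \<phi>]] adjunct_natural[OF A s \<phi>]
        assoc[OF \<eta> s \<phi>] assoc[OF comp_homs[OF \<eta> s] \<phi> C'(2)] ..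
  qed
  show ?thesis
  proof
    assume map: "\<rho>' \<odot> \<phi> = Jm \<phi> \<odot> \<rho>"
    show "\<forall>A \<in> Obj (base B). \<forall>s \<in> formal_solutions B P A. \<phi> \<odot> s \<in> formal_solutions B Q A"
    proof (intro ballI)
      fix A s
      assume A: "A \<in> Obj (base B)" and sol: "s \<in> formal_solutions B P A"
      have s: "s \<in> hm (T A) E"
        using formal_solutions_hom[OF P sol] .
      have "\<rho> \<odot> (s \<odot> \<eta> A) = adjunct B A s"
        using sol formal_solutions_iff[OF P A s] by simp
      then show "\<phi> \<odot> s \<in> formal_solutions B Q A"
        unfolding Q_iff[OF A s] map assoc[OF comp_homs[OF disk_unit_hom[OF A] s] C(2) J\<phi>] by simp
    qed
  next
    assume pres: "\<forall>A \<in> Obj (base B). \<forall>s \<in> formal_solutions B P A. \<phi> \<odot> s \<in> formal_solutions B Q A"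
    obtain s where s: "s \<in> hm (T E) E" and adj: "adjunct B E s = \<rho>"
      using adjunct_surj[OF C(2,1)] by blast
    have s\<eta>: "s \<odot> \<eta> E = Ide (base B) E"
      using counit_adjunct[OF C(1) s] adj C(3) by simp
    have "s \<in> formal_solutions B P E"
      unfolding formal_solutions_iff[OF P C(1) s] s\<eta> adj base.comp_ide_right[OF C(2)] ..
    then have "\<phi> \<odot> s \<in> formal_solutions B Q E"
      using pres C(1) by blast
    then show "\<rho>' \<odot> \<phi> = Jm \<phi> \<odot> \<rho>"
      unfolding Q_iff[OF C(1) s] s\<eta> adj base.comp_ide_right[OF comp_homs[OF \<phi> C'(2)]] .
  qed
qed

abbreviation preserves_solutions :: "'o \<times> 'a \<Rightarrow> 'a \<Rightarrow> 'o \<times> 'a \<Rightarrow> bool" where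
  "preserves_solutions P \<phi> Q \<equiv>
     \<forall>A \<in> Obj (base B). \<forall>s \<in> formal_solutions B P A. \<phi> \<odot> s \<in> formal_solutions B Q A"

lemma PDE_structured: "PDE B = structured_cat (base B)
    (\<lambda>P. generalized_pde B P \<and> formally_integrable B P) (pde_carrier B) preserves_solutions"
  by (simp add: PDE_def structured_cat_def)

lemma ex_presented_by:
  assumes "generalized_pde B P \<and> formally_integrable B P"
  obtains \<rho> where "presented_by B P (pde_carrier B P, \<rho>)"
  using assms unfolding presented_by_def formally_integrable_def PDE_def by auto

lemma category_PDE: "category (PDE B)"
  unfolding PDE_structured
proof (rule base.category_structured_cat)
  fix P assume P: "generalized_pde B P \<and> formally_integrable B P"
  then show carrier: "pde_carrier B P \<in> Obj (base B)"
    using base.hom_dom_obj unfolding generalized_pde_def by blast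
  show "preserves_solutions P (Ide (base B) (pde_carrier B P)) P"
    using base.comp_ide_left by (auto simp: formal_solutions_def)
next
  fix P Q R \<phi> \<psi>
  assume \<phi>: "\<phi> \<in> hm (pde_carrier B P) (pde_carrier B Q)"
    and \<psi>: "\<psi> \<in> hm (pde_carrier B Q) (pde_carrier B R)"
    and pres: "preserves_solutions P \<phi> Q" "preserves_solutions Q \<psi> R"
  show "preserves_solutions P (\<psi> \<odot> \<phi>) R"
  proof (intro ballI)
    fix A s
    assume A: "A \<in> Obj (base B)" and s: "s \<in> formal_solutions B P A"
    have "s \<in> hm (T A) (pde_carrier B P)"
      using s by (simp add: formal_solutions_def)
    then show "(\<psi> \<odot> \<phi>) \<odot> s \<in> formal_solutions B R A"
      using pres A s by (simp add: assoc[OF _ \<phi> \<psi>])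
  qed
qed


section \<open>Limits of coalgebras and of PDEs\<close>

lemma EM_product:
  assumes E: "coalgebra B (E, \<rho>E)" and F: "coalgebra B (F, \<rho>F)" and X: "coalgebra B (X, \<rho>)"
    and P: "is_product (base B) E F X \<pi>1 \<pi>2"
    and eq: "\<rho>E \<odot> \<pi>1 = Jm \<pi>1 \<odot> \<rho>" "\<rho>F \<odot> \<pi>2 = Jm \<pi>2 \<odot> \<rho>"
  shows "is_product (EM B) (E, \<rho>E) (F, \<rho>F) (X, \<rho>) ((X, \<rho>), \<pi>1, (E, \<rho>E)) ((X, \<rho>), \<pi>2, (F, \<rho>F))"
  unfolding EM_structured
proof (rule base.structured_product)
  fix A \<phi>
  assume A: "coalgebra B A" and \<phi>: "\<phi> \<in> hm (fst A) (fst (X, \<rho>))"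
    and "coalgebra_map A (\<pi>1 \<odot> \<phi>) (E, \<rho>E)" "coalgebra_map A (\<pi>2 \<odot> \<phi>) (F, \<rho>F)"
  then show "coalgebra_map A \<phi> (X, \<rho>)"
    using product_coalgebra_map_initial[of "fst A" "snd A", OF _ X E F _ P eq(1) _ eq(2)] by simp
qed (use assms in auto)

lemma EM_equalizer:
  assumes E: "coalgebra B (E, \<rho>E)" and F: "coalgebra B (F, \<rho>F)" and K: "coalgebra B (K, \<kappa>)"
    and f: "f \<in> hm E F" "\<rho>F \<odot> f = Jm f \<odot> \<rho>E" and g: "\<rho>F \<odot> g = Jm g \<odot> \<rho>E"
    and Eq: "is_equalizer (base B) f g e" and e: "e \<in> hm K E" "\<rho>E \<odot> e = Jm e \<odot> \<kappa>"
  shows "is_equalizer (EM B) ((E, \<rho>E), f, (F, \<rho>F)) ((E, \<rho>E), g, (F, \<rho>F)) ((K, \<kappa>), e, (E, \<rho>E))"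
  unfolding EM_structured
proof (rule base.structured_equalizer)
  fix A \<phi>
  assume A: "coalgebra B A" and \<phi>: "\<phi> \<in> hm (fst A) (fst (K, \<kappa>))"
    and "coalgebra_map A (e \<odot> \<phi>) (E, \<rho>E)"
  then show "coalgebra_map A \<phi> (K, \<kappa>)"
    using monic_coalgebra_map_initial[of "fst A" "snd A",
        OF _ K E _ e(1) base.equalizer_monic[OF Eq] e(2)] by simp
qed (use assms in auto)

lemma PDE_product:
  assumes P: "presented_by B P (E, \<rho>E)" and Q: "presented_by B Q (F, \<rho>F)"
    and R: "presented_by B R (X, \<rho>)" and prod: "is_product (base B) E F X \<pi>1 \<pi>2"
    and eq: "\<rho>E \<odot> \<pi>1 = Jm \<pi>1 \<odot> \<rho>" "\<rho>F \<odot> \<pi>2 = Jm \<pi>2 \<odot> \<rho>"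
  shows "is_product (PDE B) P Q R (R, \<pi>1, P) (R, \<pi>2, Q)"
proof -
  note DP = presented_byD[OF P] and DQ = presented_byD[OF Q] and DR = presented_byD[OF R]
  have \<pi>: "\<pi>1 \<in> hm X E" "\<pi>2 \<in> hm X F"
    using prod by (auto simp: is_product_def)
  show ?thesis
    unfolding PDE_structured
  proof (rule base.structured_product)
    show "is_product (base B) (pde_carrier B P) (pde_carrier B Q) (pde_carrier B R) \<pi>1 \<pi>2"
      using prod DP(2) DQ(2) DR(2) by simp
    show "preserves_solutions R \<pi>1 P" "preserves_solutions R \<pi>2 Q"
      using preserves_solutions_iff[OF R P \<pi>(1)] preserves_solutions_iff[OF R Q \<pi>(2)] eq by auto
    fix A \<phi>
    assume A: "generalized_pde B A \<and> formally_integrable B A"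
      and "\<phi> \<in> hm (pde_carrier B A) (pde_carrier B R)"
      and pres: "preserves_solutions A (\<pi>1 \<odot> \<phi>) P" "preserves_solutions A (\<pi>2 \<odot> \<phi>) Q"
    then have \<phi>: "\<phi> \<in> hm (pde_carrier B A) X"
      using DR(2) by simp
    obtain \<tau> where \<tau>: "presented_by B A (pde_carrier B A, \<tau>)"
      using ex_presented_by[OF A] .
    have "\<rho> \<odot> \<phi> = Jm \<phi> \<odot> \<tau>"
      using product_coalgebra_map_initial[OF presented_byD(6)[OF \<tau>] DR(6) DP(6) DQ(6) \<phi> prod eq(1)
          preserves_solutions_iff[OF \<tau> P comp_homs[OF \<phi> \<pi>(1)], THEN iffD1, OF pres(1)] eq(2)
          preserves_solutions_iff[OF \<tau> Q comp_homs[OF \<phi> \<pi>(2)], THEN iffD1, OF pres(2)]] .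
    then show "preserves_solutions A \<phi> R"
      using preserves_solutions_iff[OF \<tau> R \<phi>] by blast
  qed (fact DP(1) DQ(1) DR(1))+
qed

lemma PDE_equalizer:
  assumes P: "presented_by B P (E, \<rho>E)" and Q: "presented_by B Q (F, \<rho>F)"
    and R: "presented_by B R (K, \<kappa>)"
    and f: "f \<in> hm E F" "\<rho>F \<odot> f = Jm f \<odot> \<rho>E" and g: "g \<in> hm E F" "\<rho>F \<odot> g = Jm g \<odot> \<rho>E"
    and Eq: "is_equalizer (base B) f g e" and e: "e \<in> hm K E" "\<rho>E \<odot> e = Jm e \<odot> \<kappa>"
  shows "is_equalizer (PDE B) (P, f, Q) (P, g, Q) (R, e, P)"
proof -
  note DP = presented_byD[OF P] and DQ = presented_byD[OF Q] and DR = presented_byD[OF R]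
  show ?thesis
    unfolding PDE_structured
  proof (rule base.structured_equalizer)
    show "is_equalizer (base B) f g e"
      by (fact Eq)
    show "e \<in> hm (pde_carrier B R) (pde_carrier B P)" "f \<in> hm (pde_carrier B P) (pde_carrier B Q)"
      using e f DP(2) DQ(2) DR(2) by simp_all
    show "preserves_solutions P f Q" "preserves_solutions P g Q" "preserves_solutions R e P"
      using preserves_solutions_iff[OF P Q f(1)] preserves_solutions_iff[OF P Q g(1)]
        preserves_solutions_iff[OF R P e(1)] f g e by auto
    fix A \<phi>
    assume A: "generalized_pde B A \<and> formally_integrable B A"
      and "\<phi> \<in> hm (pde_carrier B A) (pde_carrier B R)"
      and pres: "preserves_solutions A (e \<odot> \<phi>) P"
    then have \<phi>: "\<phi> \<in> hm (pde_carrier B A) K"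
      using DR(2) by simp
    obtain \<tau> where \<tau>: "presented_by B A (pde_carrier B A, \<tau>)"
      using ex_presented_by[OF A] .
    have "\<kappa> \<odot> \<phi> = Jm \<phi> \<odot> \<tau>"
      using monic_coalgebra_map_initial[OF presented_byD(6)[OF \<tau>] DR(6) DP(6) \<phi> e(1)
          base.equalizer_monic[OF Eq] e(2)
          preserves_solutions_iff[OF \<tau> P comp_homs[OF \<phi> e(1)], THEN iffD1, OF pres]] .
    then show "preserves_solutions A \<phi> R"
      using preserves_solutions_iff[OF \<tau> R \<phi>] by blast
  qed (fact DP(1) DQ(1) DR(1))+
qed

lemma op_prolong_coalgebra_map:
  assumes Y: "Y \<in> Obj (base B)" and D: "D \<in> hm (J Y) Z"
  shows "op_prolong B Y D \<in> hm (J Y) (J Z)"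
    and "\<Delta> Z \<odot> op_prolong B Y D = Jm (op_prolong B Y D) \<odot> \<Delta> Y"
proof -
  note \<Delta>Y = coprod_hom[OF Y] and JD = jet_hom[OF D] and \<Delta>JY = coprod_hom[OF jet_obj[OF Y]]
  have Z: "Z \<in> Obj (base B)"
    using D base.hom_cod_obj by blast
  note \<Delta>Z = coprod_hom[OF Z] and J\<Delta>Y = jet_hom[OF \<Delta>Y] and JJD = jet_hom[OF JD]
  show "op_prolong B Y D \<in> hm (J Y) (J Z)"
    unfolding op_prolong_def using comp_homs[OF \<Delta>Y JD] .
  have "\<Delta> Z \<odot> op_prolong B Y D = Jm (Jm D) \<odot> (\<Delta> (J Y) \<odot> \<Delta> Y)"
    unfolding op_prolong_def assoc[OF \<Delta>Y JD \<Delta>Z, symmetric] coprod_natural[OF D]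
      assoc[OF \<Delta>Y \<Delta>JY JJD] ..
  also have "\<dots> = Jm (op_prolong B Y D) \<odot> \<Delta> Y"
    unfolding op_prolong_def jet_comp[OF \<Delta>Y JD] assoc[OF \<Delta>Y J\<Delta>Y JJD] coprod_coassoc[OF Y] ..
  finally show "\<Delta> Z \<odot> op_prolong B Y D = Jm (op_prolong B Y D) \<odot> \<Delta> Y" .
qed

text \<open>
  The prolongation of the equalizer \<open>e0\<close> of \<open>f0\<close> and \<open>g0\<close> is the pullback along \<open>\<Delta> Y\<close> of the
  equalizer \<open>J e0\<close> of \<open>J f0\<close> and \<open>J g0\<close>, which is the equalizer of \<open>J f0 \<odot> \<Delta> Y\<close> and \<open>J g0 \<odot> \<Delta> Y\<close>.
\<close>

lemma prolongation_equalizer: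
  assumes "is_equalizer (base B) f0 g0 e0" "prolongation B (Y, e0) eY \<rho>0"
  shows "is_equalizer (base B) (op_prolong B Y f0) (op_prolong B Y g0) eY"
  using base.equalizer_pullback[OF jet_equalizer[OF assms(1)]] assms(2)
  by (simp add: prolongation_def op_prolong_def)

text \<open>
  The equalizer \<open>eY\<close> of the prolonged operators is a subcoalgebra of the cofree coalgebra \<open>J Y\<close>, so the
  PDE \<open>(Y, eY)\<close> is formally integrable and its coaction is the one for which \<open>eY\<close> is the equalizer.
\<close>

lemma PDE_equalizer_prolongation:
  assumes P: "presented_by B P (cofree B Y)" and Q: "presented_by B Q (cofree B Z)"
    and Y: "Y \<in> Obj (base B)" and f0: "f0 \<in> hm (J Y) Z" and g0: "g0 \<in> hm (J Y) Z"
    and E0: "is_equalizer (base B) f0 g0 e0" and pro: "prolongation B (Y, e0) eY \<rho>0"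
  shows "(Y, eY) \<in> Obj (PDE B)"
    and "is_equalizer (PDE B) (P, op_prolong B Y f0, Q) (P, op_prolong B Y g0, Q) ((Y, eY), eY, P)"
proof -
  have Z: "Z \<in> Obj (base B)"
    using f0 base.hom_cod_obj by blast
  note P' = P[unfolded cofree_def] and Q' = Q[unfolded cofree_def]
  note f = op_prolong_coalgebra_map[OF Y f0] and g = op_prolong_coalgebra_map[OF Y g0]
  note Eq = prolongation_equalizer[OF E0 pro]
  define K where "K = Dom (base B) eY"
  have eY: "eY \<in> hm K (J Y)"
    using Eq f(1) unfolding is_equalizer_def K_def by (auto simp: hom_def)
  obtain \<kappa> where \<kappa>: "coalgebra B (K, \<kappa>)" "\<Delta> Y \<odot> eY = Jm eY \<odot> \<kappa>"
    using equalizer_coalgebra_ex1[OF presented_byD(6)[OF P'] presented_byD(6)[OF Q'] f g Eq eY]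
    by blast
  have R: "presented_by B (Y, eY) (K, \<kappa>)"
    using subcoalgebra_presented_by[OF \<kappa>(1) Y eY base.equalizer_monic[OF Eq] \<kappa>(2)[symmetric]] .
  then show "(Y, eY) \<in> Obj (PDE B)"
    by (simp add: presented_by_def)
  show "is_equalizer (PDE B) (P, op_prolong B Y f0, Q) (P, op_prolong B Y g0, Q) ((Y, eY), eY, P)"
    using PDE_equalizer[OF P' Q' R f g Eq eY \<kappa>(2)] .
qed

text \<open>The comparison of the two models \<open>J E \<times> J F\<close> and \<open>J (E \<times> F)\<close> of a product turns \<open>(\<rho>E, \<rho>F)\<close> into
  the arrow that is compatible with both projections.\<close>

lemma product_coaction:
  assumes E: "coalgebra B (E, \<rho>E)" and F: "coalgebra B (F, \<rho>F)"
    and P: "is_product (base B) E F X \<pi>1 \<pi>2" and W: "is_product (base B) (J E) (J F) W q1 q2"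
  defines "c \<equiv> tuple (base B) q1 q2 (Jm \<pi>1) (Jm \<pi>2)"
  defines "\<rho> \<equiv> inv_arr (base B) c \<odot> tuple (base B) q1 q2 (\<rho>E \<odot> \<pi>1) (\<rho>F \<odot> \<pi>2)"
  shows "is_iso (base B) c" "\<rho> \<in> hm X (J X)" "Jm \<pi>1 \<odot> \<rho> = \<rho>E \<odot> \<pi>1" "Jm \<pi>2 \<odot> \<rho> = \<rho>F \<odot> \<pi>2"
proof -
  have \<pi>: "\<pi>1 \<in> hm X E" "\<pi>2 \<in> hm X F" and q: "q1 \<in> hm W (J E)" "q2 \<in> hm W (J F)"
    using P W by (auto simp: is_product_def)
  note c = base.tuple_product[OF W jet_hom[OF \<pi>(1)] jet_hom[OF \<pi>(2)], folded c_def]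
  let ?d = "tuple (base B) q1 q2 (\<rho>E \<odot> \<pi>1) (\<rho>F \<odot> \<pi>2)"
  note d = base.tuple_product[OF W comp_homs[OF \<pi>(1) coalgebraD(2)[OF E]]
      comp_homs[OF \<pi>(2) coalgebraD(2)[OF F]]]
  show iso: "is_iso (base B) c"
    unfolding c_def using base.product_comparison_iso[OF jet_product[OF P] W] .
  note inv = base.inv_arr_iso[OF iso c(1)]
  show \<rho>: "\<rho> \<in> hm X (J X)"
    unfolding \<rho>_def using comp_homs[OF d(1) inv(1)] .
  have c\<rho>: "c \<odot> \<rho> = ?d"
    unfolding \<rho>_def assoc[OF d(1) inv(1) c(1), symmetric] inv(3) base.comp_ide_left[OF d(1)] ..
  have "Jm \<pi>1 \<odot> \<rho> = q1 \<odot> (c \<odot> \<rho>)" "Jm \<pi>2 \<odot> \<rho> = q2 \<odot> (c \<odot> \<rho>)"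
    unfolding assoc[OF \<rho> c(1) q(1), symmetric] assoc[OF \<rho> c(1) q(2), symmetric] c by simp_all
  then show "Jm \<pi>1 \<odot> \<rho> = \<rho>E \<odot> \<pi>1" "Jm \<pi>2 \<odot> \<rho> = \<rho>F \<odot> \<pi>2"
    unfolding c\<rho> d by simp_all
qed

end

section \<open>Products, equalizers and solution spaces of differential operators\<close>

theorem theorem3p57:
  fixes H :: "('o, 'a, 'p, 'b) cohesion"
    and V \<Sigma> :: 'o
    and B :: "('a, 'a \<times> 'a \<times> 'a, 'a, 'a \<times> 'a \<times> 'a) adj_triple"
    and P Q :: "'a \<times> ('a \<times> 'a \<times> 'a)"
    and E F :: 'a
    and \<rho>E \<rho>F :: "'a \<times> 'a \<times> 'a"
  assumes "differentially_cohesive_topos TYPE('u) H"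
    and "group_object (ambient H) V"
    and "V_manifold H V \<Sigma>"
    and "base_change_triple (ambient H) (Im_unit H \<Sigma>) B"
    and "P \<in> Obj (PDE B)" and "presented_by B P (E, \<rho>E)"
    and "Q \<in> Obj (PDE B)" and "presented_by B Q (F, \<rho>F)"
  shows
    \<comment> \<open>(a)\<close>
    "(\<forall>X \<pi>1 \<pi>2 W q1 q2.
        is_product (base B) E F X \<pi>1 \<pi>2 \<longrightarrow>
        is_product (base B) (fobj (jet B) E) (fobj (jet B) F) W q1 q2 \<longrightarrow>
        (let c = tuple (base B) q1 q2 (farr (jet B) \<pi>1) (farr (jet B) \<pi>2);
             \<rho> = inv_arr (base B) c \<cdot>\<^bsub>base B\<^esub>
                   tuple (base B) q1 q2 (\<rho>E \<cdot>\<^bsub>base B\<^esub> \<pi>1) (\<rho>F \<cdot>\<^bsub>base B\<^esub> \<pi>2)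
         in is_iso (base B) c
            \<and> (X, \<rho>) \<in> Obj (EM B)
            \<and> is_product (EM B) (E, \<rho>E) (F, \<rho>F)
                (X, \<rho>) ((X, \<rho>), \<pi>1, (E, \<rho>E)) ((X, \<rho>), \<pi>2, (F, \<rho>F))
            \<and> presented_by B (pde_of_coalgebra (X, \<rho>)) (X, \<rho>)
            \<and> (\<forall>R. presented_by B R (X, \<rho>) \<longrightarrow>
                 is_product (PDE B) P Q R (R, \<pi>1, P) (R, \<pi>2, Q))))
     \<and>
     (\<forall>f g e K.
        ((E, \<rho>E), f, (F, \<rho>F)) \<in> Arr (EM B) \<longrightarrow>
        ((E, \<rho>E), g, (F, \<rho>F)) \<in> Arr (EM B) \<longrightarrow>
        is_equalizer (base B) f g e \<longrightarrow> e \<in> hom (base B) K E \<longrightarrow>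
        (\<exists>!\<rho>K. (K, \<rho>K) \<in> Obj (EM B) \<and> ((K, \<rho>K), e, (E, \<rho>E)) \<in> Arr (EM B))
        \<and> (\<forall>\<rho>K. (K, \<rho>K) \<in> Obj (EM B) \<longrightarrow> ((K, \<rho>K), e, (E, \<rho>E)) \<in> Arr (EM B) \<longrightarrow>
             is_equalizer (EM B) ((E, \<rho>E), f, (F, \<rho>F)) ((E, \<rho>E), g, (F, \<rho>F))
               ((K, \<rho>K), e, (E, \<rho>E))
             \<and> presented_by B (pde_of_coalgebra (K, \<rho>K)) (K, \<rho>K)
             \<and> (\<forall>R. presented_by B R (K, \<rho>K) \<longrightarrow>
                  is_equalizer (PDE B) (P, f, Q) (P, g, Q) (R, e, P))))
     \<and>
     (\<forall>Y Z f0 g0 K0 e0 eY \<rho>0.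
        Y \<in> Obj (base B) \<longrightarrow> Z \<in> Obj (base B) \<longrightarrow>
        (E, \<rho>E) = cofree B Y \<longrightarrow> (F, \<rho>F) = cofree B Z \<longrightarrow>
        f0 \<in> hom (base B) (fobj (jet B) Y) Z \<longrightarrow> g0 \<in> hom (base B) (fobj (jet B) Y) Z \<longrightarrow>
        is_equalizer (base B) f0 g0 e0 \<longrightarrow> e0 \<in> hom (base B) K0 (fobj (jet B) Y) \<longrightarrow>
        prolongation B (Y, e0) eY \<rho>0 \<longrightarrow>
        generalized_pde B (Y, e0)
        \<and> (Y, eY) \<in> Obj (PDE B)
        \<and> is_equalizer (PDE B) (P, op_prolong B Y f0, Q) (P, op_prolong B Y g0, Q)
            ((Y, eY), eY, P)
        \<and> (\<forall>K k. is_equalizer (PDE B) (P, op_prolong B Y f0, Q) (P, op_prolong B Y g0, Q)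
                    (K, k, P) \<longrightarrow>
             (\<exists>\<theta>. is_iso (PDE B) (K, \<theta>, (Y, eY)) \<and> eY \<cdot>\<^bsub>base B\<^esub> \<theta> = k)))"
proof -
  have adj: "adjunction (base B) (total B) (sum_adj B)" "adjunction (total B) (base B) (prod_adj B)"
      "right_adj (sum_adj B) = left_adj (prod_adj B)"
    using assms(4) by (auto simp: base_change_triple_def)
  interpret adjoint_triple B
    by (intro adjoint_triple.intro adjoint_triple_axioms.intro adj
        is_functor.axioms(1)[OF adjunction.axioms(1)[OF adj(1)]])
  note P = assms(6) and Q = assms(8)
  note E = presented_byD(6)[OF P] and F = presented_byD(6)[OF Q]
  have EM_obj: "X \<in> Obj (EM B) \<longleftrightarrow> coalgebra B X" for X
    by (simp add: EM_def)
  have EM_arr: "((A, \<tau>), \<phi>, (A', \<tau>')) \<in> Arr (EM B) \<longleftrightarrow> coalgebra B (A, \<tau>) \<and> coalgebra B (A', \<tau>')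
      \<and> \<phi> \<in> hm A A' \<and> \<tau>' \<odot> \<phi> = Jm \<phi> \<odot> \<tau>" for A \<tau> \<phi> A' \<tau>'
    by (simp add: EM_def)
  show ?thesis
  proof (intro conjI)
    show "\<forall>X \<pi>1 \<pi>2 W q1 q2.
        is_product (base B) E F X \<pi>1 \<pi>2 \<longrightarrow>
        is_product (base B) (fobj (jet B) E) (fobj (jet B) F) W q1 q2 \<longrightarrow>
        (let c = tuple (base B) q1 q2 (farr (jet B) \<pi>1) (farr (jet B) \<pi>2);
             \<rho> = inv_arr (base B) c \<cdot>\<^bsub>base B\<^esub>
                   tuple (base B) q1 q2 (\<rho>E \<cdot>\<^bsub>base B\<^esub> \<pi>1) (\<rho>F \<cdot>\<^bsub>base B\<^esub> \<pi>2)
         in is_iso (base B) c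
            \<and> (X, \<rho>) \<in> Obj (EM B)
            \<and> is_product (EM B) (E, \<rho>E) (F, \<rho>F)
                (X, \<rho>) ((X, \<rho>), \<pi>1, (E, \<rho>E)) ((X, \<rho>), \<pi>2, (F, \<rho>F))
            \<and> presented_by B (pde_of_coalgebra (X, \<rho>)) (X, \<rho>)
            \<and> (\<forall>R. presented_by B R (X, \<rho>) \<longrightarrow>
                 is_product (PDE B) P Q R (R, \<pi>1, P) (R, \<pi>2, Q)))"
    proof (intro allI impI)
      fix X \<pi>1 \<pi>2 W q1 q2
      assume prod: "is_product (base B) E F X \<pi>1 \<pi>2"
        and W: "is_product (base B) (J E) (J F) W q1 q2"
      define c where "c = tuple (base B) q1 q2 (Jm \<pi>1) (Jm \<pi>2)"
      define \<rho> where
        "\<rho> = inv_arr (base B) c \<odot> tuple (base B) q1 q2 (\<rho>E \<odot> \<pi>1) (\<rho>F \<odot> \<pi>2)"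
      note \<rho> = product_coaction[OF E F prod W, folded c_def, folded \<rho>_def]
      note X = product_coalgebra[OF E F prod \<rho>(2-4)]
      show "let c = tuple (base B) q1 q2 (Jm \<pi>1) (Jm \<pi>2);
          \<rho> = inv_arr (base B) c \<odot> tuple (base B) q1 q2 (\<rho>E \<odot> \<pi>1) (\<rho>F \<odot> \<pi>2)
        in is_iso (base B) c
          \<and> (X, \<rho>) \<in> Obj (EM B)
          \<and> is_product (EM B) (E, \<rho>E) (F, \<rho>F)
              (X, \<rho>) ((X, \<rho>), \<pi>1, (E, \<rho>E)) ((X, \<rho>), \<pi>2, (F, \<rho>F))
          \<and> presented_by B (pde_of_coalgebra (X, \<rho>)) (X, \<rho>)
          \<and> (\<forall>R. presented_by B R (X, \<rho>) \<longrightarrow>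
               is_product (PDE B) P Q R (R, \<pi>1, P) (R, \<pi>2, Q))"
        unfolding Let_def c_def[symmetric] \<rho>_def[symmetric] EM_obj
        using \<rho>(1) X EM_product[OF E F X prod \<rho>(3,4)[symmetric]]
          coalgebra_presented_by_coaction[OF X] PDE_product[OF P Q _ prod \<rho>(3,4)[symmetric]]
        by blast
    qed
  next
    show "\<forall>f g e K.
        ((E, \<rho>E), f, (F, \<rho>F)) \<in> Arr (EM B) \<longrightarrow>
        ((E, \<rho>E), g, (F, \<rho>F)) \<in> Arr (EM B) \<longrightarrow>
        is_equalizer (base B) f g e \<longrightarrow> e \<in> hom (base B) K E \<longrightarrow>
        (\<exists>!\<rho>K. (K, \<rho>K) \<in> Obj (EM B) \<and> ((K, \<rho>K), e, (E, \<rho>E)) \<in> Arr (EM B))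
        \<and> (\<forall>\<rho>K. (K, \<rho>K) \<in> Obj (EM B) \<longrightarrow> ((K, \<rho>K), e, (E, \<rho>E)) \<in> Arr (EM B) \<longrightarrow>
             is_equalizer (EM B) ((E, \<rho>E), f, (F, \<rho>F)) ((E, \<rho>E), g, (F, \<rho>F))
               ((K, \<rho>K), e, (E, \<rho>E))
             \<and> presented_by B (pde_of_coalgebra (K, \<rho>K)) (K, \<rho>K)
             \<and> (\<forall>R. presented_by B R (K, \<rho>K) \<longrightarrow>
                  is_equalizer (PDE B) (P, f, Q) (P, g, Q) (R, e, P)))"
    proof (intro allI impI)
      fix f g e K
      assume "((E, \<rho>E), f, (F, \<rho>F)) \<in> Arr (EM B)" "((E, \<rho>E), g, (F, \<rho>F)) \<in> Arr (EM B)"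
        and Eq: "is_equalizer (base B) f g e" and e: "e \<in> hm K E"
      then have f: "f \<in> hm E F" "\<rho>F \<odot> f = Jm f \<odot> \<rho>E"
        and g: "g \<in> hm E F" "\<rho>F \<odot> g = Jm g \<odot> \<rho>E"
        by (auto simp: EM_arr)
      have arr: "(K, \<kappa>) \<in> Obj (EM B) \<and> ((K, \<kappa>), e, (E, \<rho>E)) \<in> Arr (EM B)
          \<longleftrightarrow> coalgebra B (K, \<kappa>) \<and> \<rho>E \<odot> e = Jm e \<odot> \<kappa>" for \<kappa>
        using E e by (auto simp: EM_obj EM_arr)
      have unique: "\<exists>!\<kappa>. (K, \<kappa>) \<in> Obj (EM B) \<and> ((K, \<kappa>), e, (E, \<rho>E)) \<in> Arr (EM B)"
        unfolding arr using equalizer_coalgebra_ex1[OF E F f g Eq e] .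
      have limit: "is_equalizer (EM B) ((E, \<rho>E), f, (F, \<rho>F)) ((E, \<rho>E), g, (F, \<rho>F))
            ((K, \<kappa>), e, (E, \<rho>E))
          \<and> presented_by B (pde_of_coalgebra (K, \<kappa>)) (K, \<kappa>)
          \<and> (\<forall>R. presented_by B R (K, \<kappa>) \<longrightarrow>
               is_equalizer (PDE B) (P, f, Q) (P, g, Q) (R, e, P))"
        if "(K, \<kappa>) \<in> Obj (EM B)" "((K, \<kappa>), e, (E, \<rho>E)) \<in> Arr (EM B)" for \<kappa>
      proof -
        have K: "coalgebra B (K, \<kappa>)" and eq: "\<rho>E \<odot> e = Jm e \<odot> \<kappa>"
          using that arr by blast+
        show ?thesis
          using EM_equalizer[OF E F K f g(2) Eq e eq] coalgebra_presented_by_coaction[OF K]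
            PDE_equalizer[OF P Q _ f g Eq e eq] by blast
      qed
      show "(\<exists>!\<rho>K. (K, \<rho>K) \<in> Obj (EM B) \<and> ((K, \<rho>K), e, (E, \<rho>E)) \<in> Arr (EM B))
        \<and> (\<forall>\<rho>K. (K, \<rho>K) \<in> Obj (EM B) \<longrightarrow> ((K, \<rho>K), e, (E, \<rho>E)) \<in> Arr (EM B) \<longrightarrow>
             is_equalizer (EM B) ((E, \<rho>E), f, (F, \<rho>F)) ((E, \<rho>E), g, (F, \<rho>F))
               ((K, \<rho>K), e, (E, \<rho>E))
             \<and> presented_by B (pde_of_coalgebra (K, \<rho>K)) (K, \<rho>K)
             \<and> (\<forall>R. presented_by B R (K, \<rho>K) \<longrightarrow>
                  is_equalizer (PDE B) (P, f, Q) (P, g, Q) (R, e, P)))"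
        using unique limit by (intro conjI allI impI) auto
    qed
  next
    show "\<forall>Y Z f0 g0 K0 e0 eY \<rho>0.
        Y \<in> Obj (base B) \<longrightarrow> Z \<in> Obj (base B) \<longrightarrow>
        (E, \<rho>E) = cofree B Y \<longrightarrow> (F, \<rho>F) = cofree B Z \<longrightarrow>
        f0 \<in> hom (base B) (fobj (jet B) Y) Z \<longrightarrow> g0 \<in> hom (base B) (fobj (jet B) Y) Z \<longrightarrow>
        is_equalizer (base B) f0 g0 e0 \<longrightarrow> e0 \<in> hom (base B) K0 (fobj (jet B) Y) \<longrightarrow>
        prolongation B (Y, e0) eY \<rho>0 \<longrightarrow>
        generalized_pde B (Y, e0)
        \<and> (Y, eY) \<in> Obj (PDE B)
        \<and> is_equalizer (PDE B) (P, op_prolong B Y f0, Q) (P, op_prolong B Y g0, Q)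
            ((Y, eY), eY, P)
        \<and> (\<forall>K k. is_equalizer (PDE B) (P, op_prolong B Y f0, Q) (P, op_prolong B Y g0, Q)
                    (K, k, P) \<longrightarrow>
             (\<exists>\<theta>. is_iso (PDE B) (K, \<theta>, (Y, eY)) \<and> eY \<cdot>\<^bsub>base B\<^esub> \<theta> = k))"
    proof (intro allI impI)
      fix Y Z f0 g0 K0 e0 eY \<rho>0
      assume Y: "Y \<in> Obj (base B)"
        and cofree: "(E, \<rho>E) = cofree B Y" "(F, \<rho>F) = cofree B Z"
        and f0: "f0 \<in> hm (J Y) Z" and g0: "g0 \<in> hm (J Y) Z"
        and E0: "is_equalizer (base B) f0 g0 e0" and e0: "e0 \<in> hm K0 (J Y)"
        and pro: "prolongation B (Y, e0) eY \<rho>0"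
      have "pde_carrier B (Y, e0) = K0"
        using e0 by (simp add: pde_carrier_def hom_def)
      then have pde: "generalized_pde B (Y, e0)"
        using Y e0 base.equalizer_monic[OF E0] by (simp add: generalized_pde_def)
      note Eq = PDE_equalizer_prolongation[OF P[unfolded cofree] Q[unfolded cofree] Y f0 g0 E0 pro]
      have "\<exists>\<theta>. is_iso (PDE B) (K, \<theta>, (Y, eY)) \<and> eY \<odot> \<theta> = k"
        if Eq': "is_equalizer (PDE B) (P, op_prolong B Y f0, Q) (P, op_prolong B Y g0, Q) (K, k, P)"
        for K k
      proof -
        have "(K, k, P) \<in> hom (PDE B) K P"
          using Eq' by (auto simp: is_equalizer_def PDE_structured hom_structured_cat)
        moreover have "((Y, eY), eY, P) \<in> hom (PDE B) (Y, eY) P"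
          using Eq(2) by (auto simp: is_equalizer_def PDE_structured hom_structured_cat)
        ultimately obtain \<theta> where \<theta>: "\<theta> \<in> hom (PDE B) K (Y, eY)" "is_iso (PDE B) \<theta>"
            "((Y, eY), eY, P) \<cdot>\<^bsub>PDE B\<^esub> \<theta> = (K, k, P)"
          using category.equalizer_unique[OF category_PDE Eq(2) Eq'] by blast
        moreover obtain \<phi> where \<phi>: "\<theta> = (K, \<phi>, (Y, eY))"
          using \<theta>(1) by (auto simp: PDE_structured hom_structured_cat)
        moreover have "eY \<odot> \<phi> = k"
          using \<theta>(3) by (simp add: \<phi> PDE_structured)
        ultimately show ?thesis
          by blast
      qed
      then show "generalized_pde B (Y, e0)
        \<and> (Y, eY) \<in> Obj (PDE B)
        \<and> is_equalizer (PDE B) (P, op_prolong B Y f0, Q) (P, op_prolong B Y g0, Q)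
            ((Y, eY), eY, P)
        \<and> (\<forall>K k. is_equalizer (PDE B) (P, op_prolong B Y f0, Q) (P, op_prolong B Y g0, Q)
                    (K, k, P) \<longrightarrow>
             (\<exists>\<theta>. is_iso (PDE B) (K, \<theta>, (Y, eY)) \<and> eY \<odot> \<theta> = k))"
        using pde Eq by blast
    qed
  qed
qed

end
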